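(* For any $\delta>0$ there exists $C_\delta>0$ such that, for any $\gamma\in(0,\gamma_0)$ and any $\omega\in\Omega_\gamma$: 1. For any $v^{(1)},\dots,v^{(4)}\in\mathcal V^{\frac12+\delta}_{t,x}$, $$\Big|\int_{\mathbb T}\int_0^\pi v^{(1)}v^{(2)}\mathcal L_\omega^{-1}(v^{(3)}v^{(4)})\sin^2(x)\tfrac2\pi dx\tfrac1\pi dt\Big|\le C_\delta\gamma^{-1}\prod_{n=1}^4\|v^{(n)}\|_{\mathcal V^{\frac12+\delta}_{t,x}}.$$ 2. For any $v^{(1)},\dots,v^{(4)}\in\mathcal V^{\frac23+\delta}_{t,x}$ and any $l\in\{1,\dots,4\}$, $$\Big|\int_{\mathbb T}\int_0^\pi v^{(1)}v^{(2)}\mathcal L_\omega^{-1}(v^{(3)}v^{(4)})\sin^2(x)\tfrac2\pi dx\tfrac1\pi dt\Big|\le C_\delta\gamma^{-1}\Big(\prod_{n\in\{1,\dots,4\},\,n\ne l}\|v^{(n)}\|_{\mathcal V^{\frac23+\delta}_{t,x}}\Big)\|v^{(l)}\|_{\mathcal V^{-\delta}_{t,x}}.$$ Furthermore, if $\omega=1$, both estimates hold with the factor $\gamma^{-1}$ on the right-hand side replaced by $1$.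
   Context: $\mathbb T=\mathbb R/2\pi\mathbb Z$, $\mathbb N=\{0,1,\dots\}$, $\mathbb N_*=\{1,2,\dots\}$. For $j\in\mathbb N$ put $e_j(x)=\frac{\sin((j+1)x)}{\sin x}$, $x\in(0,\pi)$, $\omega_j=j+1$; $\{e_j\}$ is an orthonormal basis of $L^2((0,\pi),\sin^2(x)\frac2\pi dx)$. For $s\in\mathbb R$, $\mathcal V^s_{t,x}$ is the space of real $v(t,x)=\sum_{j}v_j\cos(\omega_jt)e_j(x)$ with $\|v\|^2_{\mathcal V^s_{t,x}}=\sum_j|v_j|^2\omega_j^{2s}<\infty$. $W$ is the space of functions $\sum_{\ell,j\in\mathbb N}u_{\ell,j}\cos(\ell t)e_j(x)$ with $u_{\ell,j}=0$ whenever $\ell=\omega_j$. $\Omega_\gamma=\{\omega\in[\frac12,2]:|\omega\ell-j|\ge\gamma/\ell\ \forall\ell\in\mathbb N_*,j\in\mathbb N,\ell\ne j\}$, and $\gamma_0>0$ is a fixed small constant. On $W$, $\mathcal L_\omega^{-1}$ is the inverse of $\mathcal L_\omega=-\omega^2\partial_{tt}-A$, where $A e_j=\omega_j^2e_j$, i.e. $\mathcal L_\omega^{-1}\big(\sum_{\ell\ne\omega_j}w_{\ell,j}\cos(\ell t)e_j\big)=\sum_{\ell\ne\omega_j}\frac{w_{\ell,j}}{\omega^2\ell^2-\omega_j^2}\cos(\ell t)e_j$. The product $v^{(3)}v^{(4)}$ of two functions $v^{(3)},v^{(4)}\in\mathcal V^{\frac12+\delta}_{t,x}$ (with $\delta>0$),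 i.e. of two functions of the form $\sum_{j\in\mathbb N} v_j\cos(\omega_jt)e_j(x)$ with $\sum_j|v_j|^2\omega_j^{1+2\delta}<\infty$, belongs to $W$, so $\mathcal L_\omega^{-1}(v^{(3)}v^{(4)})$ is well defined. *)

theory Defs
  imports "HOL-Analysis.Analysis"
begin

definition freq :: "nat \<Rightarrow> real" where
  "freq j = real j + 1"

definition eig :: "nat \<Rightarrow> real \<Rightarrow> real" where
  "eig j x = sin (freq j * x) / sin x"

text \<open>
  An element \<open>\<Sum>j. c j * cos (freq j * t) * eig j x\<close> of the space of order \<open>s\<close> is
  represented by its real coefficient sequence \<open>c\<close>, so that the definition makes sense for
  every real \<open>s\<close>, including the negative orders at which the series is only a distribution.
\<close>

definition V_space :: "real \<Rightarrow> (nat \<Rightarrow> real) set" where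
  "V_space s = {c. summable (\<lambda>j. (c j)\<^sup>2 * freq j powr (2 * s))}"

definition V_norm :: "real \<Rightarrow> (nat \<Rightarrow> real) \<Rightarrow> real" where
  "V_norm s c = sqrt (\<Sum>j. (c j)\<^sup>2 * freq j powr (2 * s))"

text \<open>
  The function of \<open>(t, x)\<close> with coefficients \<open>c\<close>. For \<open>c \<in> V_space s\<close> with \<open>s > 1/2\<close> the
  sequence \<open>c\<close> is absolutely summable (Cauchy-Schwarz), and \<open>\<bar>eig j x\<bar> \<le> 1 / sin x\<close>, so the
  series converges absolutely at every \<open>x\<close> in \<open>(0, pi)\<close>.
\<close>

definition V_fun :: "(nat \<Rightarrow> real) \<Rightarrow> real \<Rightarrow> real \<Rightarrow> real" where
  "V_fun c t x = (\<Sum>j. c j * cos (freq j * t) * eig j x)"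

text \<open>
  The circle \<open>\<real>/2pi\<int>\<close> is integrated over the fundamental domain \<open>[0, 2pi]\<close>.
\<close>

definition pairing :: "(real \<Rightarrow> real \<Rightarrow> real) \<Rightarrow> (real \<Rightarrow> real \<Rightarrow> real) \<Rightarrow> real" where
  "pairing u w =
     (LBINT t:{0..2*pi}. (LBINT x:{0<..<pi}. u t x * w t x * (sin x)\<^sup>2 * (2 / pi)) * (1 / pi))"

text \<open>
  The coefficient of \<open>w\<close> along \<open>cos (l * t) * eig j x\<close>. These functions are orthogonal for
  \<open>pairing\<close>, with squared norm 1 if \<open>l > 0\<close> and 2 if \<open>l = 0\<close>.
\<close>

definition tx_coeff :: "(real \<Rightarrow> real \<Rightarrow> real) \<Rightarrow> nat \<Rightarrow> nat \<Rightarrow> real" where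
  "tx_coeff w l j =
     (if l = 0 then 1 / 2 else 1) * pairing w (\<lambda>t x. cos (real l * t) * eig j x)"

text \<open>
  The inverse of \<open>- \<omega>\<^sup>2 \<partial>\<^sub>t\<^sub>t - A\<close>, where \<open>A (eig j) = (freq j)\<^sup>2 eig j\<close>, on functions
  without modes \<open>l = freq j\<close>. If \<open>w\<close> is the product of two functions \<open>V_fun c\<close>,
  \<open>V_fun d\<close> with \<open>c, d \<in> V_space s\<close>, \<open>s > 1/2\<close>, its resonant coefficients vanish, and
  for \<open>\<omega>\<close> in \<open>Omega \<gamma>\<close>, \<open>\<gamma> > 0\<close>, the coefficients of the series below are absolutely
  summable, so the sum converges unconditionally at every \<open>x\<close> in \<open>(0, pi)\<close>.
\<close>

definition L_inv :: "real \<Rightarrow> (real \<Rightarrow> real \<Rightarrow> real) \<Rightarrow> real \<Rightarrow> real \<Rightarrow> real" where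
  "L_inv \<omega> w t x =
     (\<Sum>\<^sub>\<infinity>(l, j)\<in>{(l, j). real l \<noteq> freq j}.
        tx_coeff w l j / (\<omega>\<^sup>2 * (real l)\<^sup>2 - (freq j)\<^sup>2) * (cos (real l * t) * eig j x))"

definition Omega :: "real \<Rightarrow> real set" where
  "Omega \<gamma> = {\<omega>. 1 / 2 \<le> \<omega> \<and> \<omega> \<le> 2 \<and>
     (\<forall>l j :: nat. 1 \<le> l \<longrightarrow> l \<noteq> j \<longrightarrow> \<bar>\<omega> * real l - real j\<bar> \<ge> \<gamma> / real l)}"

definition quartic ::
  "real \<Rightarrow> (nat \<Rightarrow> real) \<Rightarrow> (nat \<Rightarrow> real) \<Rightarrow> (nat \<Rightarrow> real) \<Rightarrow> (nat \<Rightarrow> real) \<Rightarrow> real" where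
  "quartic \<omega> c1 c2 c3 c4 =
     pairing (\<lambda>t x. V_fun c1 t x * V_fun c2 t x)
             (L_inv \<omega> (\<lambda>t x. V_fun c3 t x * V_fun c4 t x))"

end

theory Submission
  imports Defs
begin

text \<open>
  Expanding everything in modes, the form is a sum over \<open>(l, j)\<close> of
  \<open>tx_coeff (v3 * v4) l j / (\<omega>\<^sup>2 * l\<^sup>2 - (freq j)\<^sup>2)\<close> times the pairing of \<open>v1 * v2\<close> with the
  mode \<open>(l, j)\<close>. The triple integral of \<open>v\<close>-modes \<open>a\<close>, \<open>b\<close> and of the mode \<open>(l, j)\<close> is bounded
  independently of \<open>j\<close> and vanishes unless \<open>l = \<plusminus> freq a \<plusminus> freq b\<close>, while the sum over \<open>j\<close> of
  \<open>1 / \<bar>\<omega>\<^sup>2 * l\<^sup>2 - (freq j)\<^sup>2\<bar>\<close> is \<open>O(1 / \<gamma>)\<close> uniformly in \<open>l\<close>. This leaves a sum of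
  \<open>\<bar>v1 a * v2 b * v3 p * v4 q\<bar>\<close> over resonant quadruples \<open>\<plusminus> a \<plusminus> b = \<plusminus> p \<plusminus> q\<close> (frequencies), which a
  Schur test bounds by the \<open>l\<^sup>2\<close> norms of any two of the sequences and the \<open>l\<^sup>1\<close> norms of the others.
  Exchanging sums and integrals is dominated convergence: the product \<open>v1 * v2 * L_inv (v3 * v4)\<close>
  times \<open>sin\<^sup>2\<close> is \<open>O(sin powr (\<eta> - 1))\<close> for some \<open>\<eta> > 0\<close>, since \<open>v1 * sin\<close> vanishes like
  \<open>sin powr \<eta>\<close> at the endpoints.
\<close>

subsection \<open>Resonance kernel and Schur test\<close>

text \<open>The arguments are mode indices with frequencies \<open>a + 1\<close> and
  \<open>b + 1\<close>: their sum is \<open>a + b + 2\<close>, while the shift cancels in the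
  difference. Two additive equations encode \<open>l = \<bar>a - b\<bar>\<close> without truncated
  subtraction.\<close>

definition chi :: "nat \<Rightarrow> nat \<Rightarrow> nat \<Rightarrow> real" where
  "chi l a b = of_bool (l = a + b + 2 \<or> l + a = b \<or> l + b = a)"

lemma chi_commute: "chi l a b = chi l b a"
  by (auto simp: chi_def add_ac)

lemma chi_nonneg: "0 \<le> chi l a b"
  by (simp add: chi_def)

text \<open>With \<open>l\<close> and \<open>b\<close> fixed, each of the three resonance relations
  determines \<open>a\<close>. Truncated subtraction can only add indicators, which is harmless in
  an upper bound.\<close>

lemma sum_chi_mode_le: "(\<Sum>a<N. chi l a b) \<le> 3"
proof -
  have "(\<Sum>a<N. chi l a b)
      \<le> (\<Sum>a<N. (if a = l - b - 2 then 1 else 0) + (if a = l + b then 1 else 0)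
            + (if a = b - l then 1 else 0))"
    by (intro sum_mono) (auto simp: chi_def)
  also have "\<dots> \<le> 3"
    by (simp only: sum.distrib sum.delta finite_lessThan) simp
  finally show ?thesis .
qed

text \<open>With \<open>a\<close> and \<open>b\<close> fixed, \<open>l\<close> is
  \<open>a + b + 2\<close> or \<open>\<bar>a - b\<bar>\<close>; the latter is the sum of the two
  truncated differences, one of which is 0.\<close>

lemma sum_chi_freq_le: "(\<Sum>l<n. chi l a b) \<le> 2"
proof -
  have "(\<Sum>l<n. chi l a b)
      \<le> (\<Sum>l<n. (if l = a + b + 2 then 1 else 0) + (if l = (a - b) + (b - a) then 1 else 0))"
    by (intro sum_mono) (auto simp: chi_def)
  also have "\<dots> \<le> 2"
    by (simp only: sum.distrib sum.delta finite_lessThan) simp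
  finally show ?thesis .
qed

text \<open>The cutoff \<open>n\<close> on the time frequency shared by the two pairs keeps the sum
  finite; all later bounds are uniform in it.\<close>

definition quad_kernel :: "nat \<Rightarrow> nat \<Rightarrow> nat \<Rightarrow> nat \<Rightarrow> nat \<Rightarrow> real" where
  "quad_kernel n a b p q = (\<Sum>l<n. chi l a b * chi l p q)"

lemma quad_kernel_nonneg: "0 \<le> quad_kernel n a b p q"
  by (simp add: quad_kernel_def sum_nonneg chi_nonneg)

lemma quad_kernel_swap: "quad_kernel n b a p q = quad_kernel n a b p q"
  by (simp add: quad_kernel_def chi_commute[of _ b a])

lemma quad_kernel_flip: "quad_kernel n p q a b = quad_kernel n a b p q"
  by (simp add: quad_kernel_def mult.commute)

text \<open>The bound is 3 times 2: at fixed \<open>l\<close> at most three \<open>a\<close>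
  resonate with \<open>b\<close>, and \<open>(p, q)\<close> admits at most two
  \<open>l\<close>.\<close>

lemma sum_quad_kernel_le: "(\<Sum>a<N. quad_kernel n a b p q) \<le> 6"
proof -
  have "(\<Sum>a<N. quad_kernel n a b p q) = (\<Sum>l<n. (\<Sum>a<N. chi l a b) * chi l p q)"
    unfolding quad_kernel_def sum_distrib_right by (rule sum.swap)
  also have "\<dots> \<le> (\<Sum>l<n. 3 * chi l p q)"
    by (intro sum_mono mult_right_mono sum_chi_mode_le chi_nonneg)
  also have "\<dots> \<le> 6"
    using sum_chi_freq_le[of p q n] by (simp add: sum_distrib_left[symmetric])
  finally show ?thesis .
qed

text \<open>A common \<open>l\<close> links the pairs: the first gives \<open>a \<le> l + b\<close>,
  the second \<open>l \<le> p + q + 2\<close>.\<close>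

lemma quad_kernel_triangle:
  assumes "quad_kernel n a b p q \<noteq> 0"
  shows "freq a \<le> freq b + freq p + freq q"
proof -
  obtain l where "chi l a b * chi l p q \<noteq> 0"
    using assms unfolding quad_kernel_def by (meson sum.neutral)
  then have "chi l a b \<noteq> 0" "chi l p q \<noteq> 0" by auto
  then have "a \<le> b + p + q + 2"
    unfolding chi_def of_bool_eq_0_iff by linarith
  then have "real a \<le> real (b + p + q + 2)" by linarith
  then show ?thesis by (simp add: freq_def)
qed

text \<open>Split \<open>k\<close> as \<open>sqrt k * sqrt k\<close>, give one factor to
  \<open>x\<close> and the other to \<open>y\<close>, and apply Cauchy-Schwarz over pairs. The
  column bound then controls the \<open>x\<close> sum, the row bound the \<open>y\<close>
  sum.\<close>

lemma schur_test:
  fixes k :: "nat \<Rightarrow> nat \<Rightarrow> real"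
  assumes k: "\<And>a b. 0 \<le> k a b"
    and row: "\<And>b. (\<Sum>a<N. k a b) \<le> M" and col: "\<And>a. (\<Sum>b<N. k a b) \<le> M"
  shows "(\<Sum>a<N. \<Sum>b<N. x a * y b * k a b)
    \<le> M * sqrt (\<Sum>a<N. (x a)\<^sup>2) * sqrt (\<Sum>b<N. (y b)\<^sup>2)"
proof -
  let ?I = "{..<N} \<times> {..<N}"
  have M: "0 \<le> M" using row[of 0] sum_nonneg[of "{..<N}" "\<lambda>a. k a 0"] k by force
  have *: "(\<Sum>a<N. \<Sum>b<N. x a * y b * k a b)
      = (\<Sum>i\<in>?I. (x (fst i) * sqrt (k (fst i) (snd i))) * (y (snd i) * sqrt (k (fst i) (snd i))))"
    unfolding sum.cartesian_product using k
    by (intro sum.cong) (auto simp: algebra_simps real_sqrt_mult_self)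
  have "(\<Sum>i\<in>?I. (x (fst i) * sqrt (k (fst i) (snd i)))\<^sup>2) = (\<Sum>a<N. (x a)\<^sup>2 * (\<Sum>b<N. k a b))"
    unfolding sum_distrib_left sum.cartesian_product using k
    by (intro sum.cong) (auto simp: power_mult_distrib)
  also have "\<dots> \<le> (\<Sum>a<N. (x a)\<^sup>2 * M)"
    by (intro sum_mono mult_left_mono col) auto
  finally have 1: "(\<Sum>i\<in>?I. (x (fst i) * sqrt (k (fst i) (snd i)))\<^sup>2) \<le> M * (\<Sum>a<N. (x a)\<^sup>2)"
    by (simp add: sum_distrib_left mult.commute)
  have "(\<Sum>i\<in>?I. (y (snd i) * sqrt (k (fst i) (snd i)))\<^sup>2)
      = (\<Sum>a<N. \<Sum>b<N. (y b)\<^sup>2 * k a b)"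
    unfolding sum.cartesian_product using k
    by (intro sum.cong) (auto simp: power_mult_distrib)
  also have "\<dots> = (\<Sum>b<N. (y b)\<^sup>2 * (\<Sum>a<N. k a b))"
    unfolding sum_distrib_left by (rule sum.swap)
  also have "\<dots> \<le> (\<Sum>b<N. (y b)\<^sup>2 * M)"
    by (intro sum_mono mult_left_mono row) auto
  finally have 2: "(\<Sum>i\<in>?I. (y (snd i) * sqrt (k (fst i) (snd i)))\<^sup>2) \<le> M * (\<Sum>b<N. (y b)\<^sup>2)"
    by (simp add: sum_distrib_left mult.commute)
  have "(\<Sum>a<N. \<Sum>b<N. x a * y b * k a b)\<^sup>2
      \<le> (\<Sum>i\<in>?I. (x (fst i) * sqrt (k (fst i) (snd i)))\<^sup>2)
        * (\<Sum>i\<in>?I. (y (snd i) * sqrt (k (fst i) (snd i)))\<^sup>2)"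
    unfolding * by (rule Cauchy_Schwarz_ineq_sum)
  also have "\<dots> \<le> (M * (\<Sum>a<N. (x a)\<^sup>2)) * (M * (\<Sum>b<N. (y b)\<^sup>2))"
    using M by (intro mult_mono 1 2 mult_nonneg_nonneg sum_nonneg) auto
  also have "\<dots> = (M * sqrt (\<Sum>a<N. (x a)\<^sup>2) * sqrt (\<Sum>b<N. (y b)\<^sup>2))\<^sup>2"
    by (simp add: power_mult_distrib sum_nonneg) (simp add: power2_eq_square mult_ac)
  finally show ?thesis
    by (rule power2_le_imp_le) (use M in \<open>simp add: sum_nonneg\<close>)
qed

text \<open>At fixed \<open>p\<close>, \<open>q\<close> the Schur test acts in \<open>(a, b)\<close>
  with a constant independent of \<open>p\<close>, \<open>q\<close>, so \<open>z\<close> and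
  \<open>w\<close> contribute only their plain sums.\<close>

lemma quad_sum_le:
  fixes k :: "nat \<Rightarrow> nat \<Rightarrow> nat \<Rightarrow> nat \<Rightarrow> real"
  assumes k: "\<And>a b p q. 0 \<le> k a b p q"
    and row: "\<And>b p q. (\<Sum>a<N. k a b p q) \<le> M" and col: "\<And>a p q. (\<Sum>b<N. k a b p q) \<le> M"
    and z: "\<And>p. 0 \<le> z p" and w: "\<And>q. 0 \<le> w q"
  shows "(\<Sum>p<N. \<Sum>q<N. \<Sum>a<N. \<Sum>b<N. x a * y b * z p * w q * k a b p q)
    \<le> M * sqrt (\<Sum>a<N. (x a)\<^sup>2) * sqrt (\<Sum>b<N. (y b)\<^sup>2) * (\<Sum>p<N. z p) * (\<Sum>q<N. w q)"
proof -
  let ?B = "M * sqrt (\<Sum>a<N. (x a)\<^sup>2) * sqrt (\<Sum>b<N. (y b)\<^sup>2)"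
  have "(\<Sum>p<N. \<Sum>q<N. \<Sum>a<N. \<Sum>b<N. x a * y b * z p * w q * k a b p q)
      = (\<Sum>p<N. \<Sum>q<N. z p * w q * (\<Sum>a<N. \<Sum>b<N. x a * y b * k a b p q))"
    unfolding sum_distrib_left by (intro sum.cong refl) (simp only: mult_ac)
  also have "\<dots> \<le> (\<Sum>p<N. \<Sum>q<N. z p * w q * ?B)"
    by (intro sum_mono mult_left_mono schur_test k row col mult_nonneg_nonneg z w)
  also have "\<dots> = ?B * (\<Sum>p<N. z p) * (\<Sum>q<N. w q)"
    by (simp add: sum_distrib_left sum_distrib_right mult_ac)
  finally show ?thesis .
qed

subsection \<open>Norms and the quadrilinear sums\<close>

lemma freq_ge_1: "1 \<le> freq j" and freq_pos: "0 < freq j"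
  by (simp_all add: freq_def)

lemma freq_neq_0 [simp]: "freq j \<noteq> 0"
  using freq_pos[of j] by simp

lemma V_space_mono:
  assumes "s' \<le> s" "c \<in> V_space s"
  shows "c \<in> V_space s'"
proof -
  have "summable (\<lambda>j. (c j)\<^sup>2 * freq j powr (2 * s'))"
    by (rule summable_comparison_test'[where N = 0 and g = "\<lambda>j. (c j)\<^sup>2 * freq j powr (2 * s)"])
      (use assms freq_ge_1 in \<open>auto simp: V_space_def intro!: mult_left_mono powr_mono\<close>)
  then show ?thesis by (simp add: V_space_def)
qed

lemma V_norm_mono:
  assumes "s' \<le> s" "c \<in> V_space s"
  shows "V_norm s' c \<le> V_norm s c"
  unfolding V_norm_def using assms V_space_mono[OF assms] freq_ge_1
  by (auto simp: V_space_def intro!: suminf_le mult_left_mono powr_mono)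

lemma V_norm_nonneg: "c \<in> V_space s \<Longrightarrow> 0 \<le> V_norm s c"
  by (auto simp: V_norm_def V_space_def intro!: suminf_nonneg)

lemma sqrt_sum_le_V_norm:
  assumes "c \<in> V_space s"
  shows "sqrt (\<Sum>j<N. (\<bar>c j\<bar> * freq j powr s)\<^sup>2) \<le> V_norm s c"
proof -
  have "(\<bar>c j\<bar> * freq j powr s)\<^sup>2 = (c j)\<^sup>2 * freq j powr (2 * s)" for j
    by (simp add: power_mult_distrib power2_eq_square[of "freq j powr s"] powr_add[symmetric])
  then show ?thesis
    using assms unfolding V_norm_def V_space_def
    by (auto intro!: sum_le_suminf)
qed

lemma sqrt_sum_le_V_norm':
  assumes "c \<in> V_space s" "s' \<le> s"
  shows "sqrt (\<Sum>j<N. (\<bar>c j\<bar> * freq j powr s')\<^sup>2) \<le> V_norm s c"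
  using sqrt_sum_le_V_norm[OF V_space_mono[OF assms(2,1)]] V_norm_mono[OF assms(2,1)]
  by (rule order_trans)

lemma summable_freq_powr: "p < -1 \<Longrightarrow> summable (\<lambda>j. freq j powr p)"
  using summable_Suc_iff[of "\<lambda>j. real j powr p"]
  by (simp add: freq_def summable_real_powr_iff add.commute)

text \<open>The square root of the Riemann zeta function at \<open>1 + 2 * r\<close>, which is the
  Cauchy-Schwarz constant for the embedding into \<open>l^1\<close>.\<close>

definition l1_const :: "real \<Rightarrow> real" where
  "l1_const r = sqrt (\<Sum>j. freq j powr (- (1 + 2 * r)))"

lemma l1_const_pos: "0 < r \<Longrightarrow> 0 < l1_const r"
  unfolding l1_const_def
  by (auto intro!: suminf_pos summable_freq_powr)

text \<open>Cauchy-Schwarz against \<open>freq j powr (\<eta> - (1/2 + \<delta>))\<close>, whose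
  square has exponent \<open>- (1 + 2 * (\<delta> - \<eta>))\<close>, below -1 because
  \<open>\<eta> < \<delta>\<close>. The case \<open>\<eta> = 0\<close> is the plain
  \<open>l^1\<close> bound; a positive \<open>\<eta>\<close> later buys decay at the endpoints of
  \<open>(0, pi)\<close>.\<close>

lemma weighted_l1_le:
  assumes "c \<in> V_space (1/2 + \<delta>)" "\<eta> < \<delta>"
  shows "(\<Sum>j<N. \<bar>c j\<bar> * freq j powr \<eta>) \<le> l1_const (\<delta> - \<eta>) * V_norm (1/2 + \<delta>) c"
proof -
  let ?s = "1/2 + \<delta>"
  have "(\<Sum>j<N. \<bar>c j\<bar> * freq j powr \<eta>)
      = (\<Sum>j<N. freq j powr (\<eta> - ?s) * (\<bar>c j\<bar> * freq j powr ?s))"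
    by (intro sum.cong refl) (simp add: powr_add[symmetric])
  also have "\<dots> \<le> sqrt ((\<Sum>j<N. (freq j powr (\<eta> - ?s))\<^sup>2) * (\<Sum>j<N. (\<bar>c j\<bar> * freq j powr ?s)\<^sup>2))"
    by (intro real_le_rsqrt Cauchy_Schwarz_ineq_sum)
  also have "\<dots> = sqrt (\<Sum>j<N. (freq j powr (\<eta> - ?s))\<^sup>2)
      * sqrt (\<Sum>j<N. (\<bar>c j\<bar> * freq j powr ?s)\<^sup>2)"
    by (rule real_sqrt_mult)
  also have "\<dots> \<le> l1_const (\<delta> - \<eta>) * V_norm ?s c"
  proof (intro mult_mono sqrt_sum_le_V_norm assms)
    have "(\<Sum>j<N. (freq j powr (\<eta> - ?s))\<^sup>2) = (\<Sum>j<N. freq j powr (- (1 + 2 * (\<delta> - \<eta>))))"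
      by (simp add: power2_eq_square powr_add[symmetric] algebra_simps)
    then show "sqrt (\<Sum>j<N. (freq j powr (\<eta> - ?s))\<^sup>2) \<le> l1_const (\<delta> - \<eta>)"
      unfolding l1_const_def using assms(2)
      by (simp only: real_sqrt_le_iff, intro sum_le_suminf summable_freq_powr) auto
  qed (use assms l1_const_pos[of "\<delta> - \<eta>"] in \<open>auto intro: sum_nonneg\<close>)
  finally show ?thesis .
qed

lemma weighted_l1_summable:
  assumes "c \<in> V_space (1/2 + \<delta>)" "\<eta> < \<delta>"
  shows "summable (\<lambda>j. \<bar>c j\<bar> * freq j powr \<eta>)"
  by (rule summableI_nonneg_bounded[OF _ weighted_l1_le[OF assms]]) simp

lemma l1_le:
  assumes "c \<in> V_space (1/2 + \<delta>)" "0 < \<delta>"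
  shows "(\<Sum>j<N. \<bar>c j\<bar>) \<le> l1_const \<delta> * V_norm (1/2 + \<delta>) c"
  using weighted_l1_le[OF assms] freq_pos by (simp add: less_le)

lemma l1_summable:
  assumes "c \<in> V_space (1/2 + \<delta>)" "0 < \<delta>"
  shows "summable (\<lambda>j. \<bar>c j\<bar>)"
  by (rule summableI_nonneg_bounded[OF _ l1_le[OF assms]]) simp

section \<open>Symmetries and bounds of the resonant quadrilinear sum\<close>

definition quad_sum ::
  "nat \<Rightarrow> nat \<Rightarrow> (nat \<Rightarrow> real) \<Rightarrow> (nat \<Rightarrow> real) \<Rightarrow> (nat \<Rightarrow> real) \<Rightarrow> (nat \<Rightarrow> real) \<Rightarrow> real" where
  "quad_sum n N x y z w =
     (\<Sum>p<N. \<Sum>q<N. \<Sum>a<N. \<Sum>b<N. x a * y b * z p * w q * quad_kernel n a b p q)"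

text \<open>Together with the swaps inside each pair, this moves any of the four sequences into the
  first slot, so the negative norm has to be treated only there.\<close>

lemma quad_sum_flip: "quad_sum n N z w x y = quad_sum n N x y z w"
proof -
  let ?f = "\<lambda>(p, q, a, b). (a, b, p, q :: nat)"
  show ?thesis
    unfolding quad_sum_def sum.cartesian_product
    by (rule sum.reindex_bij_witness[of _ ?f ?f])
      (auto simp: quad_kernel_flip)
qed

lemma quad_sum_swap: "quad_sum n N y x z w = quad_sum n N x y z w"
  unfolding quad_sum_def
  by (subst (4) sum.swap) (simp add: quad_kernel_swap mult.commute mult.left_commute)

lemma quad_sum_swap34: "quad_sum n N x y w z = quad_sum n N x y z w"
  by (metis quad_sum_flip quad_sum_swap)

lemma quad_sum_le_12:
  assumes "\<And>p. 0 \<le> z p" "\<And>q. 0 \<le> w q"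
  shows "quad_sum n N x y z w
    \<le> 6 * sqrt (\<Sum>a<N. (x a)\<^sup>2) * sqrt (\<Sum>b<N. (y b)\<^sup>2) * (\<Sum>p<N. z p) * (\<Sum>q<N. w q)"
  unfolding quad_sum_def
proof (intro quad_sum_le quad_kernel_nonneg assms sum_quad_kernel_le)
  show "(\<Sum>b<N. quad_kernel n a b p q) \<le> 6" for a p q
    using sum_quad_kernel_le[of n a p q N] by (simp add: quad_kernel_swap)
qed

text \<open>The kernel can be summed over any single index with bound 6, so the two
  \<open>l^2\<close> factors may also sit in opposite pairs. This is used when the factor absorbing
  the loss of the first sequence lies in the other pair.\<close>

lemma quad_sum_le_13:
  assumes "\<And>b. 0 \<le> y b" "\<And>q. 0 \<le> w q"
  shows "quad_sum n N x y z w
    \<le> 6 * sqrt (\<Sum>a<N. (x a)\<^sup>2) * sqrt (\<Sum>p<N. (z p)\<^sup>2) * (\<Sum>b<N. y b) * (\<Sum>q<N. w q)"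
proof -
  let ?f = "\<lambda>(b, q, a, p). (p, q, a, b :: nat)"
  have "quad_sum n N x y z w
      = (\<Sum>b<N. \<Sum>q<N. \<Sum>a<N. \<Sum>p<N. x a * z p * y b * w q * quad_kernel n a b p q)"
    unfolding quad_sum_def sum.cartesian_product
    by (rule sum.reindex_bij_witness[of _ ?f ?f]) auto
  also have "\<dots> \<le> 6 * sqrt (\<Sum>a<N. (x a)\<^sup>2) * sqrt (\<Sum>p<N. (z p)\<^sup>2) * (\<Sum>b<N. y b) * (\<Sum>q<N. w q)"
  proof (intro quad_sum_le quad_kernel_nonneg assms sum_quad_kernel_le)
    show "(\<Sum>p<N. quad_kernel n a b p q) \<le> 6" for a b q
      using sum_quad_kernel_le[of n q a b N] by (simp add: quad_kernel_flip[of n _ _ a b])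
  qed
  finally show ?thesis .
qed

text \<open>Two sequences are placed in \<open>l^2\<close>, controlled since
  \<open>0 \<le> 1/2 + \<delta>\<close>; the other two are placed in \<open>l^1\<close>, each
  costing one \<open>l1_const \<delta>\<close>.\<close>

lemma quad_sum_bound:
  assumes "0 < \<delta>" and V: "c \<in> V_space (1/2 + \<delta>)" "d \<in> V_space (1/2 + \<delta>)"
    "e \<in> V_space (1/2 + \<delta>)" "f \<in> V_space (1/2 + \<delta>)"
  shows "quad_sum n N (\<lambda>a. \<bar>c a\<bar>) (\<lambda>b. \<bar>d b\<bar>) (\<lambda>p. \<bar>e p\<bar>) (\<lambda>q. \<bar>f q\<bar>)
    \<le> 6 * (l1_const \<delta>)\<^sup>2 * (V_norm (1/2 + \<delta>) c * V_norm (1/2 + \<delta>) d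
        * V_norm (1/2 + \<delta>) e * V_norm (1/2 + \<delta>) f)"
proof -
  let ?s = "1/2 + \<delta>"
  have L: "0 < l1_const \<delta>" using assms by (simp add: l1_const_pos)
  have l2: "sqrt (\<Sum>j<N. (\<bar>v j\<bar>)\<^sup>2) \<le> V_norm ?s v" if "v \<in> V_space ?s" for v
    using sqrt_sum_le_V_norm'[OF that, of 0 N] \<open>0 < \<delta>\<close> freq_pos by (simp add: less_le)
  have "quad_sum n N (\<lambda>a. \<bar>c a\<bar>) (\<lambda>b. \<bar>d b\<bar>) (\<lambda>p. \<bar>e p\<bar>) (\<lambda>q. \<bar>f q\<bar>)
      \<le> 6 * sqrt (\<Sum>a<N. (\<bar>c a\<bar>)\<^sup>2) * sqrt (\<Sum>b<N. (\<bar>d b\<bar>)\<^sup>2) * (\<Sum>p<N. \<bar>e p\<bar>) * (\<Sum>q<N. \<bar>f q\<bar>)"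
    by (rule quad_sum_le_12) auto
  also have "\<dots> \<le> 6 * V_norm ?s c * V_norm ?s d * (l1_const \<delta> * V_norm ?s e) * (l1_const \<delta> * V_norm ?s f)"
    using assms L
    by (intro mult_mono l2 l1_le mult_nonneg_nonneg sum_nonneg) (auto intro!: V_norm_nonneg sum_nonneg)
  finally show ?thesis by (simp add: power2_eq_square mult_ac)
qed

text \<open>Comparison with three times the maximum works for every positive exponent, concave or
  not; the power of the maximum is one of the three powers on the right.\<close>

lemma powr_triangle3:
  assumes "0 < \<delta>" "0 \<le> (b::real)" "0 \<le> p" "0 \<le> q" "0 \<le> a" "a \<le> b + p + q"
  shows "a powr \<delta> \<le> 3 powr \<delta> * (b powr \<delta> + p powr \<delta> + q powr \<delta>)"
proof -
  define m where "m = max b (max p q)"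
  have "a powr \<delta> \<le> (3 * m) powr \<delta>"
    using assms by (intro powr_mono2) (auto simp: m_def)
  also have "\<dots> = 3 powr \<delta> * m powr \<delta>"
    using assms by (simp add: powr_mult m_def)
  also have "m powr \<delta> \<le> b powr \<delta> + p powr \<delta> + q powr \<delta>"
    by (auto simp: m_def max_def)
  finally show ?thesis by simp
qed

text \<open>
  On the support of the kernel the frequency carrying the negative norm is at most the sum of the
  other three, so its loss \<open>\<delta>\<close> is absorbed by the largest of them, which is then measured in
  \<open>l\<^sup>2\<close> while the remaining two are measured in \<open>l\<^sup>1\<close>.
\<close>

lemma quad_sum_bound_neg:
  assumes "0 < \<delta>" and c: "c \<in> V_space (- \<delta>)" and V: "d \<in> V_space (1/2 + \<delta>)"
    "e \<in> V_space (1/2 + \<delta>)" "f \<in> V_space (1/2 + \<delta>)"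
  shows "quad_sum n N (\<lambda>a. \<bar>c a\<bar>) (\<lambda>b. \<bar>d b\<bar>) (\<lambda>p. \<bar>e p\<bar>) (\<lambda>q. \<bar>f q\<bar>)
    \<le> 18 * 3 powr \<delta> * (l1_const \<delta>)\<^sup>2 * (V_norm (1/2 + \<delta>) d
        * V_norm (1/2 + \<delta>) e * V_norm (1/2 + \<delta>) f * V_norm (- \<delta>) c)"
proof -
  let ?s = "1/2 + \<delta>"
  let ?Q = "quad_sum n N"
  \<comment> \<open>The \<open>l^2\<close> norm of \<open>c'\<close> is controlled by the negative
    norm of \<open>c\<close>; the compensating weight \<open>freq a powr \<delta>\<close> is handed
    to one of the other sequences through \<open>up\<close>.\<close>
  define c' where "c' a = \<bar>c a\<bar> * freq a powr (- \<delta>)" for a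
  define up where "up v a = \<bar>v a\<bar> * freq a powr \<delta>" for v :: "nat \<Rightarrow> real" and a
  define ab where "ab v a = \<bar>v a\<bar>" for v :: "nat \<Rightarrow> real" and a :: nat
  have c_eq: "\<bar>c a\<bar> = c' a * freq a powr \<delta>" for a
    using freq_pos[of a] by (simp add: c'_def powr_minus field_simps)
  have c'_nonneg: "0 \<le> c' a" for a by (simp add: c'_def)
  have term_le: "\<bar>c a\<bar> * \<bar>d b\<bar> * \<bar>e p\<bar> * \<bar>f q\<bar> * quad_kernel n a b p q
      \<le> 3 powr \<delta> * (c' a * up d b * ab e p * ab f q * quad_kernel n a b p q
        + c' a * ab d b * up e p * ab f q * quad_kernel n a b p q
        + c' a * ab d b * ab e p * up f q * quad_kernel n a b p q)" for a b p q
  proof (cases "quad_kernel n a b p q = 0")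
    case False
    have "freq a powr \<delta> \<le> 3 powr \<delta> * (freq b powr \<delta> + freq p powr \<delta> + freq q powr \<delta>)"
      using quad_kernel_triangle[OF False] assms(1) freq_pos
      by (intro powr_triangle3) (auto simp: less_imp_le)
    then have "c' a * \<bar>d b\<bar> * \<bar>e p\<bar> * \<bar>f q\<bar> * quad_kernel n a b p q * freq a powr \<delta>
        \<le> c' a * \<bar>d b\<bar> * \<bar>e p\<bar> * \<bar>f q\<bar> * quad_kernel n a b p q
          * (3 powr \<delta> * (freq b powr \<delta> + freq p powr \<delta> + freq q powr \<delta>))"
      by (intro mult_left_mono mult_nonneg_nonneg c'_nonneg quad_kernel_nonneg) auto
    then show ?thesis by (simp add: c_eq up_def ab_def algebra_simps)
  qed simp
  have "?Q (\<lambda>a. \<bar>c a\<bar>) (\<lambda>b. \<bar>d b\<bar>) (\<lambda>p. \<bar>e p\<bar>) (\<lambda>q. \<bar>f q\<bar>)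
      \<le> 3 powr \<delta> * (?Q c' (up d) (ab e) (ab f) + ?Q c' (ab d) (up e) (ab f) + ?Q c' (ab d) (ab e) (up f))"
    unfolding quad_sum_def sum.distrib[symmetric] sum_distrib_left
    by (intro sum_mono term_le)
  also have "\<dots> \<le> 3 powr \<delta> *
     (6 * (l1_const \<delta>)\<^sup>2 * (V_norm ?s d * V_norm ?s e * V_norm ?s f * V_norm (- \<delta>) c)
    + 6 * (l1_const \<delta>)\<^sup>2 * (V_norm ?s d * V_norm ?s e * V_norm ?s f * V_norm (- \<delta>) c)
    + 6 * (l1_const \<delta>)\<^sup>2 * (V_norm ?s d * V_norm ?s e * V_norm ?s f * V_norm (- \<delta>) c))"
  proof (intro mult_left_mono add_mono)
    have c2: "sqrt (\<Sum>a<N. (c' a)\<^sup>2) \<le> V_norm (- \<delta>) c"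
      unfolding c'_def by (rule sqrt_sum_le_V_norm[OF c])
    have up2: "sqrt (\<Sum>a<N. (up v a)\<^sup>2) \<le> V_norm ?s v" if "v \<in> V_space ?s" for v
      unfolding up_def by (rule sqrt_sum_le_V_norm'[OF that]) simp
    have ab1: "(\<Sum>a<N. ab v a) \<le> l1_const \<delta> * V_norm ?s v" if "v \<in> V_space ?s" for v
      unfolding ab_def by (rule l1_le[OF that assms(1)])
    have L: "0 < l1_const \<delta>" using assms by (simp add: l1_const_pos)
    have ab0: "0 \<le> ab v a" for v a by (simp add: ab_def)
    have *: "6 * sqrt (\<Sum>a<N. (c' a)\<^sup>2) * sqrt (\<Sum>a<N. (up v a)\<^sup>2) * (\<Sum>a<N. ab v' a) * (\<Sum>a<N. ab v'' a)
       \<le> 6 * V_norm (- \<delta>) c * V_norm ?s v * (l1_const \<delta> * V_norm ?s v') * (l1_const \<delta> * V_norm ?s v'')"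
      if "v \<in> V_space ?s" "v' \<in> V_space ?s" "v'' \<in> V_space ?s" for v v' v''
      using that c L
      by (intro mult_mono c2 up2 ab1 mult_nonneg_nonneg sum_nonneg ab0)
         (auto intro!: V_norm_nonneg sum_nonneg)
    show "?Q c' (up d) (ab e) (ab f)
        \<le> 6 * (l1_const \<delta>)\<^sup>2 * (V_norm ?s d * V_norm ?s e * V_norm ?s f * V_norm (- \<delta>) c)"
      using order_trans[OF quad_sum_le_12[OF ab0 ab0] *[OF V(1,2,3)]]
      by (simp add: power2_eq_square mult_ac)
    show "?Q c' (ab d) (up e) (ab f)
        \<le> 6 * (l1_const \<delta>)\<^sup>2 * (V_norm ?s d * V_norm ?s e * V_norm ?s f * V_norm (- \<delta>) c)"
      using order_trans[OF quad_sum_le_13[OF ab0 ab0] *[OF V(2,1,3)]]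
      by (simp add: power2_eq_square mult_ac)
    \<comment> \<open>Exchanging slots three and four reduces the last term to the case just
      treated.\<close>
    have "?Q c' (ab d) (up f) (ab e)
        \<le> 6 * (l1_const \<delta>)\<^sup>2 * (V_norm ?s d * V_norm ?s e * V_norm ?s f * V_norm (- \<delta>) c)"
      using order_trans[OF quad_sum_le_13[OF ab0 ab0] *[OF V(3,1,2)]]
      by (simp add: power2_eq_square mult_ac)
    then show "?Q c' (ab d) (ab e) (up f)
        \<le> 6 * (l1_const \<delta>)\<^sup>2 * (V_norm ?s d * V_norm ?s e * V_norm ?s f * V_norm (- \<delta>) c)"
      by (simp only: quad_sum_swap34)
  qed simp
  finally show ?thesis by (simp add: algebra_simps)
qed

subsection \<open>Small divisors\<close>

text \<open>The value is \<open>pi\<^sup>2 / 3\<close>; the 2 counts the integers on both sides of a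
  centre.\<close>

definition res_const :: real where
  "res_const = 2 * (\<Sum>k. 1 / (real k + 1)\<^sup>2)"

lemma summable_inverse_Suc_square: "summable (\<lambda>k. 1 / (real k + 1)\<^sup>2)"
  using summable_Suc_iff[of "\<lambda>k. 1 / (real k)\<^sup>2"] inverse_power_summable[of 2, where 'a = real]
  by (simp add: inverse_eq_divide add.commute)

lemma res_const_pos: "0 < res_const"
  unfolding res_const_def
  by (auto intro!: suminf_pos summable_inverse_Suc_square simp: add_pos_nonneg)

text \<open>On each side of \<open>z\<close> the distance to \<open>z\<close> determines
  \<open>j\<close>, so each half of the sum injects into the series of inverse squares.\<close>

lemma sum_inverse_square_int_le:
  assumes "finite J"
  shows "(\<Sum>j\<in>J. 1 / (real_of_int \<bar>int j - z\<bar> + 1)\<^sup>2) \<le> res_const"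
proof -
  let ?g = "\<lambda>k. 1 / (real k + 1)\<^sup>2"
  have sub: "(\<Sum>j\<in>I. 1 / (real_of_int \<bar>int j - z\<bar> + 1)\<^sup>2) \<le> (\<Sum>k. ?g k)"
    if "finite I" "inj_on (\<lambda>j. nat \<bar>int j - z\<bar>) I" for I
  proof -
    have "(\<Sum>j\<in>I. 1 / (real_of_int \<bar>int j - z\<bar> + 1)\<^sup>2) = (\<Sum>k\<in>(\<lambda>j. nat \<bar>int j - z\<bar>) ` I. ?g k)"
      by (subst sum.reindex[OF that(2)]) simp
    also have "\<dots> \<le> (\<Sum>k. ?g k)"
      using that by (intro sum_le_suminf summable_inverse_Suc_square) auto
    finally show ?thesis .
  qed
  let ?I = "{j\<in>J. z \<le> int j}" and ?I' = "{j\<in>J. \<not> z \<le> int j}"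
  have "J = ?I \<union> ?I'" by auto
  then have "(\<Sum>j\<in>J. 1 / (real_of_int \<bar>int j - z\<bar> + 1)\<^sup>2)
      = (\<Sum>j\<in>?I. 1 / (real_of_int \<bar>int j - z\<bar> + 1)\<^sup>2) + (\<Sum>j\<in>?I'. 1 / (real_of_int \<bar>int j - z\<bar> + 1)\<^sup>2)"
    using assms by (subst sum.union_disjoint[symmetric]) auto
  also have "\<dots> \<le> (\<Sum>k. ?g k) + (\<Sum>k. ?g k)"
    using assms by (intro add_mono sub) (auto simp: inj_on_def)
  finally show ?thesis by (simp add: res_const_def)
qed

text \<open>An \<open>l^1\<close> bound in \<open>j\<close>, uniform in the time frequency
  \<open>l\<close>, on the diagonal entries of the inverse operator; quantifying over finite
  \<open>J\<close> avoids infinite sums.\<close>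

definition resolvent_bound :: "real \<Rightarrow> real \<Rightarrow> bool" where
  "resolvent_bound \<omega> K \<longleftrightarrow> (\<forall>l J. finite J \<longrightarrow>
     (\<Sum>j\<in>{j\<in>J. real l \<noteq> freq j}. 1 / \<bar>\<omega>\<^sup>2 * (real l)\<^sup>2 - (freq j)\<^sup>2\<bar>) \<le> K)"

lemma resolvent_boundI:
  assumes "0 \<le> M"
    and le: "\<And>l j. real l \<noteq> freq j \<Longrightarrow> 1 / \<bar>\<omega>\<^sup>2 * (real l)\<^sup>2 - (freq j)\<^sup>2\<bar>
        \<le> M / (\<bar>freq j - of_int (z l)\<bar> + 1)\<^sup>2"
  shows "resolvent_bound \<omega> (M * res_const)"
  unfolding resolvent_bound_def
proof (intro allI impI)
  fix l :: nat and J :: "nat set"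
  assume J: "finite J"
  have "(\<Sum>j\<in>{j\<in>J. real l \<noteq> freq j}. 1 / \<bar>\<omega>\<^sup>2 * (real l)\<^sup>2 - (freq j)\<^sup>2\<bar>)
      \<le> (\<Sum>j\<in>{j\<in>J. real l \<noteq> freq j}. M / (\<bar>freq j - of_int (z l)\<bar> + 1)\<^sup>2)"
    by (intro sum_mono le) auto
  \<comment> \<open>Since \<open>freq j = j + 1\<close>, the centre in terms of the index is
    \<open>z l - 1\<close>.\<close>
  also have "\<dots> = M * (\<Sum>j\<in>{j\<in>J. real l \<noteq> freq j}. 1 / (real_of_int \<bar>int j - (z l - 1)\<bar> + 1)\<^sup>2)"
    by (simp add: sum_distrib_left freq_def algebra_simps)
  also have "\<dots> \<le> M * res_const"
    using J assms(1) by (intro mult_left_mono sum_inverse_square_int_le) auto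
  finally show "(\<Sum>j\<in>{j\<in>J. real l \<noteq> freq j}. 1 / \<bar>\<omega>\<^sup>2 * (real l)\<^sup>2 - (freq j)\<^sup>2\<bar>) \<le> M * res_const" .
qed

text \<open>For nonnegative \<open>m\<close>, \<open>c\<close> the factor \<open>m + c\<close> is at
  least \<open>\<bar>m - c\<bar>\<close>.\<close>

lemma square_diff_ge:
  fixes m c :: real
  assumes "0 \<le> m" "0 \<le> c" "0 \<le> k" "k \<le> \<bar>m - c\<bar>"
  shows "k\<^sup>2 \<le> \<bar>m\<^sup>2 - c\<^sup>2\<bar>"
proof -
  have "k * k \<le> \<bar>m - c\<bar> * (m + c)"
    using assms by (intro mult_mono) auto
  also have "\<dots> = \<bar>m\<^sup>2 - c\<^sup>2\<bar>"
    using assms by (simp add: square_diff_square_factored power2_eq_square abs_mult mult.commute)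
  finally show ?thesis by (simp add: power2_eq_square)
qed

text \<open>Off resonance the integers \<open>l\<close> and \<open>freq j\<close> differ by at least
  1, so there is no small divisor; the 4 comes from \<open>?k + 1 \<le> 2 * ?k\<close>.\<close>

lemma resolvent_bound_1: "resolvent_bound 1 (4 * res_const)"
proof (rule resolvent_boundI[where z = int])
  fix l j assume ne: "real l \<noteq> freq j"
  let ?k = "\<bar>freq j - real_of_int (int l)\<bar>"
  have "1 \<le> ?k"
  proof -
    have "l \<noteq> j + 1" using ne by (auto simp: freq_def)
    then have "1 \<le> \<bar>int j + 1 - int l\<bar>" by linarith
    moreover have "?k = of_int \<bar>int j + 1 - int l\<bar>" by (simp add: freq_def)
    ultimately show ?thesis by linarith
  qed
  have "?k\<^sup>2 \<le> \<bar>(real l)\<^sup>2 - (freq j)\<^sup>2\<bar>"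
    using freq_pos[of j] by (intro square_diff_ge) auto
  then have "1 / \<bar>(real l)\<^sup>2 - (freq j)\<^sup>2\<bar> \<le> 1 / ?k\<^sup>2"
    using \<open>1 \<le> ?k\<close> by (intro divide_left_mono) (auto intro!: mult_pos_pos intro: less_le_trans[of 0 "?k\<^sup>2"])
  also have "\<dots> \<le> 4 / (?k + 1)\<^sup>2"
  proof -
    have "(?k + 1)\<^sup>2 \<le> (2 * ?k)\<^sup>2" using \<open>1 \<le> ?k\<close> by (intro power_mono) auto
    then show ?thesis using \<open>1 \<le> ?k\<close> by (simp add: divide_simps power_mult_distrib)
  qed
  finally show "1 / \<bar>1\<^sup>2 * (real l)\<^sup>2 - (freq j)\<^sup>2\<bar> \<le> 4 / (?k + 1)\<^sup>2" by simp
qed simp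

text \<open>
  Only the at most three \<open>j\<close> nearest to \<open>\<omega> * l\<close> see the small divisor; there
  \<open>\<bar>\<omega> * l - freq j\<bar> \<ge> \<gamma> / l\<close> is compensated by the second factor \<open>\<omega> * l + freq j \<ge> l / 2\<close>.
\<close>

lemma resolvent_bound_Omega:
  assumes "0 < \<gamma>" "\<gamma> < \<gamma>0" "\<omega> \<in> Omega \<gamma>"
  shows "resolvent_bound \<omega> ((8 + 9 * \<gamma>0) / \<gamma> * res_const)"
proof (rule resolvent_boundI[where z = "\<lambda>l. \<lfloor>\<omega> * real l\<rfloor>"])
  fix l j assume ne: "real l \<noteq> freq j"
  define m where "m = \<omega> * real l"
  define c where "c = freq j"
  define k where "k = \<bar>c - of_int \<lfloor>m\<rfloor>\<bar>"
  \<comment> \<open>Near modes contribute \<open>2 / \<gamma>\<close>, which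
    \<open>(k + 1)\<^sup>2 \<le> 4\<close> turns into \<open>8 / \<gamma>\<close>. Far modes
    contribute the constant 9, at most \<open>9 * \<gamma>0 / \<gamma>\<close> since
    \<open>\<gamma> < \<gamma>0\<close>.\<close>
  let ?M = "(8 + 9 * \<gamma>0) / \<gamma>"
  have \<omega>: "1/2 \<le> \<omega>" using assms by (auto simp: Omega_def)
  have c: "1 \<le> c" by (simp add: c_def freq_ge_1)
  have m: "0 \<le> m" using \<omega> by (simp add: m_def)
  have D: "\<omega>\<^sup>2 * (real l)\<^sup>2 - (freq j)\<^sup>2 = m\<^sup>2 - c\<^sup>2"
    by (simp add: m_def c_def power_mult_distrib)
  have M: "?M = 8 / \<gamma> + 9 * (\<gamma>0 / \<gamma>)" using assms by (simp add: field_simps)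
  have "1 \<le> \<gamma>0 / \<gamma>" using assms by simp
  moreover have "0 < 8 / \<gamma>" using assms by simp
  ultimately have M9: "9 \<le> ?M" and M8: "8 / \<gamma> \<le> ?M"
    unfolding M by linarith+
  \<comment> \<open>As a distance between two integers, \<open>k\<close> takes no value strictly
    between 1 and 2.\<close>
  have kint: "k \<le> 1 \<or> 2 \<le> k"
  proof -
    have "k = of_int \<bar>int j + 1 - \<lfloor>m\<rfloor>\<bar>" by (simp add: k_def c_def freq_def)
    moreover have "i \<le> 1 \<or> 2 \<le> i" for i :: int by linarith
    ultimately show ?thesis by (metis of_int_le_1_iff of_int_numeral_le_iff)
  qed
  have k0: "0 \<le> k" by (simp add: k_def)
  have "1 / \<bar>m\<^sup>2 - c\<^sup>2\<bar> \<le> ?M / (k + 1)\<^sup>2"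
  proof (cases "2 \<le> k")
    case True
    \<comment> \<open>Replacing \<open>m\<close> by its floor costs at most 1;
      \<open>2 \<le> k\<close> then gives \<open>k + 1 \<le> 3 * (k - 1)\<close>, hence the factor
      9.\<close>
    have "k - 1 \<le> \<bar>m - c\<bar>" unfolding k_def by linarith
    then have *: "(k - 1)\<^sup>2 \<le> \<bar>m\<^sup>2 - c\<^sup>2\<bar>"
      using True c m by (intro square_diff_ge) auto
    have "(k + 1)\<^sup>2 \<le> (3 * (k - 1))\<^sup>2" using True by (intro power_mono) auto
    also have "\<dots> = 9 * (k - 1)\<^sup>2" by (simp only: power_mult_distrib) simp
    finally have "1 / (k - 1)\<^sup>2 \<le> 9 / (k + 1)\<^sup>2"
      using True by (simp add: divide_simps)
    moreover have "1 / \<bar>m\<^sup>2 - c\<^sup>2\<bar> \<le> 1 / (k - 1)\<^sup>2"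
      using * True by (intro divide_left_mono) (auto intro!: mult_pos_pos intro: less_le_trans[of 0 "(k - 1)\<^sup>2"])
    moreover have "9 / (k + 1)\<^sup>2 \<le> ?M / (k + 1)\<^sup>2"
      using M9 by (rule divide_right_mono) simp
    ultimately show ?thesis by linarith
  next
    case False
    then have k1: "k \<le> 1" using kint by simp
    show ?thesis
    proof (cases "l = 0")
      case True
      \<comment> \<open>The Diophantine condition says nothing at \<open>l = 0\<close>; there the
        only near mode is \<open>c = 1\<close>, whose divisor has modulus 1.\<close>
      then have "m = 0" by (simp add: m_def)
      then have "c = 1" using k1 c by (simp add: k_def)
      with \<open>m = 0\<close> have "k = 1" by (simp add: k_def)
      show ?thesis using M9 by (simp add: \<open>m = 0\<close> \<open>c = 1\<close> \<open>k = 1\<close>)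
    next
      case l: False
      have "l \<noteq> j + 1" using ne by (auto simp: freq_def)
      then have "\<gamma> / real l \<le> \<bar>\<omega> * real l - real (j + 1)\<bar>"
        using assms(3) l unfolding Omega_def by (metis (mono_tags, lifting) less_one mem_Collect_eq not_less)
      then have "\<gamma> / real l \<le> \<bar>m - c\<bar>"
        by (simp add: m_def c_def freq_def)
      moreover have "real l / 2 \<le> m + c"
        using mult_right_mono[OF \<omega>, of "real l"] c by (simp add: m_def)
      ultimately have "\<gamma> / real l * (real l / 2) \<le> \<bar>m - c\<bar> * (m + c)"
        using assms by (intro mult_mono) auto
      also have "\<dots> = \<bar>m\<^sup>2 - c\<^sup>2\<bar>"
        using m c by (simp add: square_diff_square_factored power2_eq_square abs_mult mult.commute)
      finally have "\<gamma> / 2 \<le> \<bar>m\<^sup>2 - c\<^sup>2\<bar>" using l by simp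
      then have "1 / \<bar>m\<^sup>2 - c\<^sup>2\<bar> \<le> 1 / (\<gamma> / 2)"
        using assms by (intro frac_le) auto
      also have "\<dots> = (8 / \<gamma>) / 4" by simp
      also have "\<dots> \<le> ?M / 4" using M8 by (rule divide_right_mono) simp
      also have "\<dots> \<le> ?M / (k + 1)\<^sup>2"
      proof (rule divide_left_mono)
        show "(k + 1)\<^sup>2 \<le> 4" using power_mono[of "k + 1" 2 2] k1 k0 by simp
        show "0 \<le> ?M" using M9 by linarith
        show "0 < 4 * (k + 1)\<^sup>2" using k0 by simp
      qed
      finally show ?thesis .
    qed
  qed
  then show "1 / \<bar>\<omega>\<^sup>2 * (real l)\<^sup>2 - (freq j)\<^sup>2\<bar>
      \<le> ?M / (\<bar>freq j - of_int \<lfloor>\<omega> * real l\<rfloor>\<bar> + 1)\<^sup>2"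
    unfolding D by (simp add: k_def c_def m_def)
qed (use assms in auto)

subsection \<open>Trigonometric integrals\<close>

lemma integral_cos_Icc:
  fixes b :: real
  assumes "0 \<le> b"
  shows "(LBINT t:{0..b}. cos (of_int k * t)) = (if k = 0 then b else sin (of_int k * b) / of_int k)"
proof (cases "k = 0")
  case True
  then show ?thesis using assms by (simp add: set_lebesgue_integral_def)
next
  case False
  have "(LBINT t:{0..b}. cos (of_int k * t))
      = sin (of_int k * b) / of_int k - sin (of_int k * 0) / of_int k"
    unfolding set_lebesgue_integral_def
    by (rule integral_FTC_atLeastAtMost)
      (use assms False in \<open>auto intro!: derivative_eq_intros continuous_intros
         simp: has_real_derivative_iff_has_vector_derivative[symmetric]\<close>)
  then show ?thesis using False by simp
qed

lemma integral_cos_period: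
  "(LBINT t:{0..2*pi}. cos (of_int k * t)) = (if k = 0 then 2 * pi else 0)"
proof -
  have "sin (of_int k * (2 * pi)) = 0" by (metis mult.commute sin_int_2pin)
  then show ?thesis by (subst integral_cos_Icc) auto
qed

lemma set_integral_Ioo_Icc:
  fixes f :: "real \<Rightarrow> real"
  assumes "a \<le> b"
  shows "(LBINT x:{a<..<b}. f x) = (LBINT x:{a..b}. f x)"
  using interval_integral_Icc[OF assms, of f] interval_integral_Ioo[of a b f] assms by simp

lemma integral_cos_half_period:
  "(LBINT x:{0<..<pi}. cos (of_int k * x)) = (if k = 0 then pi else 0)"
proof -
  have "sin (of_int k * pi) = 0" by (simp add: sin_zero_iff_int2)
  then show ?thesis by (subst set_integral_Ioo_Icc) (auto simp: integral_cos_Icc)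
qed

lemma set_integrable_Icc_cos: "set_integrable lborel {a..b} (\<lambda>x::real. cos (c * x))"
  by (intro borel_integrable_atLeastAtMost' continuous_intros)

lemma set_integrable_Ioo_cos: "set_integrable lborel {a<..<b} (\<lambda>x::real. cos (c * x))"
  by (rule set_integrable_subset[OF set_integrable_Icc_cos[of a b c]]) auto

text \<open>The triple product is a quarter of a sum of four cosines with integer frequencies, and
  over a full period only a zero frequency survives. \<open>?k1\<close> is positive; the other three
  vanish exactly in the three cases of \<open>chi\<close>.\<close>

lemma time_integral_bound:
  "\<bar>(LBINT t:{0..2*pi}. cos (freq a * t) * cos (freq b * t) * cos (real l * t)) * (1 / pi)\<bar>
    \<le> 2 * chi l a b"
proof -
  let ?k1 = "int l + int a + int b + 2" and ?k2 = "int l - int a - int b - 2"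
    and ?k3 = "int l + int a - int b" and ?k4 = "int l - int a + int b"
  let ?I = "\<lambda>k. (LBINT t:{0..2*pi}. cos (of_int k * t))"
  have "cos (freq a * t) * cos (freq b * t) * cos (real l * t)
      = (1/4) * (cos (of_int ?k1 * t) + cos (of_int ?k2 * t) + cos (of_int ?k3 * t) + cos (of_int ?k4 * t))"
    for t
  proof -
    let ?x = "freq a * t" and ?y = "freq b * t" and ?z = "real l * t"
    have "of_int ?k1 * t = ?z + ?x + ?y" "of_int ?k2 * t = ?z - ?x - ?y"
      "of_int ?k3 * t = ?z + ?x - ?y" "of_int ?k4 * t = ?z - ?x + ?y"
      by (simp_all add: freq_def algebra_simps)
    then show ?thesis
      by (simp only: cos_add cos_diff sin_add sin_diff) (simp add: algebra_simps)
  qed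
  then have "(LBINT t:{0..2*pi}. cos (freq a * t) * cos (freq b * t) * cos (real l * t))
      = (1/4) * (?I ?k1 + ?I ?k2 + ?I ?k3 + ?I ?k4)"
    by (simp only: set_integral_mult_right set_integral_add set_integrable_Icc_cos)
  also have "\<dots> = (1/4) * (2 * pi) * (of_bool (?k1 = 0) + of_bool (?k2 = 0) + of_bool (?k3 = 0) + of_bool (?k4 = 0))"
    unfolding integral_cos_period by simp
  finally have "(LBINT t:{0..2*pi}. cos (freq a * t) * cos (freq b * t) * cos (real l * t)) * (1 / pi)
      = (1/2) * (of_bool (?k1 = 0) + of_bool (?k2 = 0) + of_bool (?k3 = 0) + of_bool (?k4 = 0))"
    by simp
  also have "\<bar>\<dots>\<bar> \<le> 2 * chi l a b"
    by (auto simp: chi_def)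
  finally show ?thesis .
qed

section \<open>Spatial integrals of three sine modes\<close>

lemma abs_sin_mult_le: "\<bar>sin (real n * x)\<bar> \<le> real n * \<bar>sin x\<bar>"
proof (induction n)
  case (Suc n)
  have "\<bar>sin (real (Suc n) * x)\<bar> = \<bar>sin (real n * x) * cos x + cos (real n * x) * sin x\<bar>"
    by (simp add: algebra_simps sin_add)
  also have "\<dots> \<le> \<bar>sin (real n * x)\<bar> * \<bar>cos x\<bar> + \<bar>cos (real n * x)\<bar> * \<bar>sin x\<bar>"
    by (metis abs_mult abs_triangle_ineq)
  also have "\<dots> \<le> \<bar>sin (real n * x)\<bar> * 1 + 1 * \<bar>sin x\<bar>"
    by (intro add_mono mult_left_mono mult_right_mono) auto
  also have "\<dots> \<le> real (Suc n) * \<bar>sin x\<bar>" using Suc by (simp add: algebra_simps)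
  finally show ?case .
qed simp

text \<open>Where \<open>sin x\<close> vanishes the quotient is 0 by the division convention, so the
  bound holds at every real \<open>x\<close>.\<close>

lemma abs_sin_quotient_le: "\<bar>sin (real n * x) / sin x\<bar> \<le> real n"
  using abs_sin_mult_le[of n x] by (cases "sin x = 0") (auto simp: field_simps abs_divide)

lemma set_integrable_bounded_Ioo:
  fixes f :: "real \<Rightarrow> real"
  assumes "f \<in> borel_measurable borel" "\<And>x. x \<in> {a<..<b} \<Longrightarrow> \<bar>f x\<bar> \<le> B"
  shows "set_integrable lborel {a<..<b} f"
proof (rule set_integrable_bound[where f = "\<lambda>_. B"])
  show "set_integrable lborel {a<..<b} (\<lambda>_. B)"
    by (cases "a \<le> b") (auto simp: set_integrable_def)
  show "set_borel_measurable lborel {a<..<b} f"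
    using assms(1) by (simp add: set_borel_measurable_def)
  show "AE x in lborel. x \<in> {a<..<b} \<longrightarrow> norm (f x) \<le> norm B"
    using assms(2) by (intro AE_I2) fastforce
qed

text \<open>The Clebsch-Gordan rule for SU(2) in terms of dimensions: the functions
  \<open>eig\<close> are its irreducible characters, and for positive arguments this says that
  dimension \<open>c\<close> occurs in the tensor product of dimensions \<open>a\<close> and
  \<open>b\<close>.\<close>

definition clebsch :: "nat \<Rightarrow> nat \<Rightarrow> nat \<Rightarrow> bool" where
  "clebsch a b c \<longleftrightarrow> odd (a + b + c) \<and> a < b + c \<and> b < a + c \<and> c < a + b"

text \<open>
  Induction in steps of two:
  \<open>sin ((c + 2) * x) - sin (c * x) = 2 * cos ((c + 1) * x) * sin x\<close> cancels the denominator.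
\<close>

lemma integral_sin_sin_sin_quotient:
  assumes "0 < a" "0 < b"
  shows "(LBINT x:{0<..<pi}. sin (real a * x) * sin (real b * x) * (sin (real c * x) / sin x))
    = (pi / 2) * of_bool (clebsch a b c)"
proof (induction c rule: nat_less_induct)
  case (1 c)
  let ?f = "\<lambda>c x. sin (real a * x) * sin (real b * x) * (sin (real c * x) / sin x)"
  let ?I = "\<lambda>k. (LBINT x:{0<..<pi}. cos (of_int k * x))"
  consider "c = 0" | "c = 1" | d where "c = d + 2"
    by (metis One_nat_def add_2_eq_Suc' not0_implies_Suc)
  then show ?case
  proof cases
    case 1
    then show ?thesis by (simp add: clebsch_def)
  next
    case 2
    let ?k1 = "int a - int b" and ?k2 = "int a + int b"
    have "?f 1 x = (1/2) * (cos (of_int ?k1 * x) - cos (of_int ?k2 * x))" if "x \<in> {0<..<pi}" for x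
      using sin_gt_zero[of x] that by (simp add: algebra_simps cos_add cos_diff)
    then have "(LBINT x:{0<..<pi}. ?f 1 x)
       = (LBINT x:{0<..<pi}. (1/2) * (cos (of_int ?k1 * x) - cos (of_int ?k2 * x)))"
      by (intro set_lebesgue_integral_cong) auto
    also have "\<dots> = (1/2) * (?I ?k1 - ?I ?k2)"
      by (simp only: set_integral_mult_right set_integral_diff set_integrable_Ioo_cos)
    also have "\<dots> = (pi / 2) * of_bool (clebsch a b c)"
      unfolding integral_cos_half_period using assms 2 by (auto simp: clebsch_def)
    finally show ?thesis using 2 by simp
  next
    case 3
    let ?k1 = "int a - int b + (int d + 1)" and ?k2 = "int a - int b - (int d + 1)"
      and ?k3 = "int a + int b + (int d + 1)" and ?k4 = "int a + int b - (int d + 1)"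
    let ?g = "\<lambda>x. (1/2) * (cos (of_int ?k1 * x) + cos (of_int ?k2 * x) - cos (of_int ?k3 * x) - cos (of_int ?k4 * x))"
    have "?f c x = ?f d x + ?g x" if "x \<in> {0<..<pi}" for x
    proof -
      have s: "0 < sin x" using that by (intro sin_gt_zero) auto
      let ?y = "(real d + 1) * x"
      have "sin (real c * x) = sin (?y + x)" "sin (real d * x) = sin (?y - x)"
        using 3 by (simp_all add: algebra_simps)
      then have "sin (real c * x) = sin (real d * x) + 2 * cos ?y * sin x"
        by (simp only: sin_add sin_diff)
      then have "?f c x = ?f d x + sin (real a * x) * sin (real b * x) * (2 * cos ?y)"
        using s by (simp add: add_divide_distrib algebra_simps)
      also have "sin (real a * x) * sin (real b * x) * (2 * cos ?y) = ?g x"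
      proof -
        have "of_int ?k1 * x = real a * x - real b * x + ?y" "of_int ?k2 * x = real a * x - real b * x - ?y"
          "of_int ?k3 * x = real a * x + real b * x + ?y" "of_int ?k4 * x = real a * x + real b * x - ?y"
          by (simp_all add: algebra_simps)
        then show ?thesis
          by (simp only: cos_add cos_diff sin_add sin_diff) (simp add: algebra_simps)
      qed
      finally show ?thesis .
    qed
    then have "(LBINT x:{0<..<pi}. ?f c x) = (LBINT x:{0<..<pi}. ?f d x + ?g x)"
      by (intro set_lebesgue_integral_cong) auto
    also have "\<dots> = (LBINT x:{0<..<pi}. ?f d x) + (LBINT x:{0<..<pi}. ?g x)"
    proof (rule set_integral_add)
      show "set_integrable lborel {0<..<pi} (?f d)"
      proof (rule set_integrable_bounded_Ioo[where B = "real d"])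
        fix x
        have "\<bar>?f d x\<bar> \<le> 1 * 1 * real d"
          unfolding abs_mult by (intro mult_mono abs_sin_quotient_le) auto
        then show "\<bar>?f d x\<bar> \<le> real d" by simp
      qed measurable
      show "set_integrable lborel {0<..<pi} ?g"
        by (intro set_integrable_mult_right set_integral_add set_integral_diff set_integrable_Ioo_cos)
    qed
    also have "(LBINT x:{0<..<pi}. ?g x) = (1/2) * (?I ?k1 + ?I ?k2 - ?I ?k3 - ?I ?k4)"
      by (simp only: set_integral_mult_right set_integral_add set_integral_diff set_integrable_Ioo_cos)
    also have "\<dots> = (pi / 2) * (of_bool (?k1 = 0) + of_bool (?k2 = 0) - of_bool (?k3 = 0) - of_bool (?k4 = 0))"
      unfolding integral_cos_half_period by simp
    also have "(LBINT x:{0<..<pi}. ?f d x) = (pi / 2) * of_bool (clebsch a b d)"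
      using 1 3 by simp
    also have "(pi / 2) * of_bool (clebsch a b d)
        + (pi / 2) * (of_bool (?k1 = 0) + of_bool (?k2 = 0) - of_bool (?k3 = 0) - of_bool (?k4 = 0))
        = (pi / 2) * (of_bool (clebsch a b d)
        + (of_bool (?k1 = 0) + of_bool (?k2 = 0) - of_bool (?k3 = 0) - of_bool (?k4 = 0)))"
      by (simp only: distrib_left)
    also have "of_bool (clebsch a b d)
        + (of_bool (?k1 = 0) + of_bool (?k2 = 0) - of_bool (?k3 = 0) - of_bool (?k4 = 0))
        = (of_bool (clebsch a b c) :: real)"
    proof (cases "odd (a + b + d)")
      case True
      \<comment> \<open>By parity no triangle inequality is an equality, so raising the third entry
        from \<open>d\<close> to \<open>d + 2\<close> gains an inequality only where
        \<open>?k1\<close> or \<open>?k2\<close> vanishes and loses one only where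
        \<open>?k4\<close> vanishes; \<open>?k3\<close> is positive.\<close>
      then have ne: "a + b + d \<noteq> 2 * k" for k by (metis dvd_triv_left)
      have "a \<noteq> b + d" "b \<noteq> a + d" "d \<noteq> a + b"
        using ne[of a] ne[of b] ne[of d] by linarith+
      moreover have "d + 2 \<noteq> a + b"
        using ne[of "d + 1"] by auto
      ultimately have "a < b + c \<longleftrightarrow> a < b + d \<or> ?k2 = 0" "b < a + c \<longleftrightarrow> b < a + d \<or> ?k1 = 0"
        "c < a + b \<longleftrightarrow> d < a + b \<and> ?k4 \<noteq> 0" "?k2 = 0 \<Longrightarrow> \<not> a < b + d \<and> b < a + d \<and> d < a + b \<and> ?k4 \<noteq> 0"
        "?k1 = 0 \<Longrightarrow> \<not> b < a + d \<and> a < b + d \<and> d < a + b \<and> ?k4 \<noteq> 0"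
        "?k3 \<noteq> 0" "?k4 = 0 \<Longrightarrow> a < b + d \<and> b < a + d \<and> d < a + b"
        using assms 3 by linarith+
      moreover have "odd (a + b + c)" using True 3 by simp
      ultimately show ?thesis
        using True unfolding clebsch_def
        by (cases "?k1 = 0"; cases "?k2 = 0"; cases "?k4 = 0") simp_all
    next
      case False
      \<comment> \<open>In the other parity class all four frequencies are odd, so there is no
        correction, and the condition fails for both \<open>d\<close> and \<open>c\<close>.\<close>
      then have "even (int a + int b + int d)" by (simp flip: of_nat_add)
      then have "odd ?k1" "odd ?k2" "odd ?k3" "odd ?k4" by auto
      then have "?k1 \<noteq> 0" "?k2 \<noteq> 0" "?k3 \<noteq> 0" "?k4 \<noteq> 0" by (metis dvd_0_right)+
      then show ?thesis using False 3 by (simp add: clebsch_def)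
    qed
    finally show ?thesis .
  qed
qed

subsection \<open>Mixed integrals and dominated convergence\<close>

definition mixed_int :: "(real \<Rightarrow> real \<Rightarrow> real) \<Rightarrow> real" where
  "mixed_int h = (LBINT t:{0..2*pi}. (LBINT x:{0<..<pi}. h t x) * (1 / pi))"

lemma pairing_eq_mixed_int:
  "pairing u w = mixed_int (\<lambda>t x. u t x * w t x * (sin x)\<^sup>2 * (2 / pi))"
  by (simp add: pairing_def mixed_int_def)

text \<open>The majorant depends on \<open>x\<close> alone, so inner integrals are bounded uniformly
  in \<open>t\<close>, and a constant is integrable over the period. Joint measurability makes the
  inner integral measurable in \<open>t\<close>.\<close>

definition dominated :: "(real \<Rightarrow> real) \<Rightarrow> (real \<Rightarrow> real \<Rightarrow> real) \<Rightarrow> bool" where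
  "dominated G h \<longleftrightarrow> set_integrable lborel {0<..<pi} G
     \<and> case_prod h \<in> borel_measurable (lborel \<Otimes>\<^sub>M lborel)
     \<and> (\<forall>t. \<forall>x\<in>{0<..<pi}. \<bar>h t x\<bar> \<le> G x)"

lemma dominatedD:
  assumes "dominated G h"
  shows dominated_integrable: "set_integrable lborel {0<..<pi} G"
    and dominated_measurable: "case_prod h \<in> borel_measurable (lborel \<Otimes>\<^sub>M lborel)"
    and dominated_bound: "\<And>t x. x \<in> {0<..<pi} \<Longrightarrow> \<bar>h t x\<bar> \<le> G x"
  using assms by (auto simp: dominated_def)

lemma dominated_section_measurable:
  assumes "dominated G h"
  shows "h t \<in> borel_measurable lborel"
  using measurable_compose[OF measurable_Pair1' dominated_measurable[OF assms], of t] by simp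

lemma dominated_section_integrable:
  assumes "dominated G h"
  shows "set_integrable lborel {0<..<pi} (h t)"
proof (rule set_integrable_bound[OF dominated_integrable[OF assms]])
  show "set_borel_measurable lborel {0<..<pi} (h t)"
    using dominated_section_measurable[OF assms, of t] by (simp add: set_borel_measurable_def)
  show "AE x in lborel. x \<in> {0<..<pi} \<longrightarrow> norm (h t x) \<le> norm (G x)"
    using dominated_bound[OF assms, of _ t] by (intro AE_I2) (auto intro: order_trans abs_ge_self)
qed

lemma dominated_inner_bound:
  assumes "dominated G h"
  shows "\<bar>LBINT x:{0<..<pi}. h t x\<bar> \<le> (LBINT x:{0<..<pi}. G x)"
proof -
  have "\<bar>LBINT x:{0<..<pi}. h t x\<bar> \<le> (LBINT x:{0<..<pi}. \<bar>h t x\<bar>)"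
    using set_integral_norm_bound[OF dominated_section_integrable[OF assms]] by simp
  also have "\<dots> \<le> (LBINT x:{0<..<pi}. G x)"
    using dominated_bound[OF assms]
    by (intro set_integral_mono set_integrable_abs dominated_section_integrable[OF assms]
        dominated_integrable[OF assms]) auto
  finally show ?thesis .
qed

lemma dominated_inner_measurable:
  assumes "dominated G h"
  shows "(\<lambda>t. LBINT x:{0<..<pi}. h t x) \<in> borel_measurable lborel"
proof -
  note [measurable] = dominated_measurable[OF assms]
  show ?thesis
    unfolding set_lebesgue_integral_def by measurable
qed

lemma dominated_outer_integrable:
  assumes "dominated G h"
  shows "set_integrable lborel {0..2*pi} (\<lambda>t. (LBINT x:{0<..<pi}. h t x) * (1 / pi))"
proof (rule set_integrable_bound[where f = "\<lambda>_. (LBINT x:{0<..<pi}. G x) * (1 / pi)"])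
  show "set_integrable lborel {0..2*pi} (\<lambda>_. (LBINT x:{0<..<pi}. G x) * (1 / pi))"
    by (simp add: set_integrable_def)
  show "set_borel_measurable lborel {0..2*pi} (\<lambda>t. (LBINT x:{0<..<pi}. h t x) * (1 / pi))"
    using dominated_inner_measurable[OF assms] by (simp add: set_borel_measurable_def)
  show "AE t in lborel. t \<in> {0..2*pi} \<longrightarrow> norm ((LBINT x:{0<..<pi}. h t x) * (1 / pi))
      \<le> norm ((LBINT x:{0<..<pi}. G x) * (1 / pi))"
    using dominated_inner_bound[OF assms]
    by (intro AE_I2)
      (auto simp: abs_mult intro!: divide_right_mono intro: order_trans abs_ge_self)
qed

lemma set_dominated_convergence:
  fixes f :: "nat \<Rightarrow> real \<Rightarrow> real"
  assumes "set_integrable lborel A w" and "\<And>n. f n \<in> borel_measurable lborel"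
    and A: "A \<in> sets lborel"
    and "\<And>n x. x \<in> A \<Longrightarrow> \<bar>f n x\<bar> \<le> w x" and "\<And>x. x \<in> A \<Longrightarrow> (\<lambda>n. f n x) \<longlonglongrightarrow> g x"
  shows "(\<lambda>n. LBINT x:A. f n x) \<longlonglongrightarrow> (LBINT x:A. g x)"
  unfolding set_lebesgue_integral_def
proof (rule integral_dominated_convergence[where w = "\<lambda>x. indicator A x *\<^sub>R w x"])
  have lim: "(\<lambda>n. indicator A x *\<^sub>R f n x) \<longlonglongrightarrow> indicator A x *\<^sub>R g x" for x
    using assms(5)[of x] by (cases "x \<in> A") auto
  show meas: "(\<lambda>x. indicator A x *\<^sub>R f n x) \<in> borel_measurable lborel" for n
    using assms(2)[of n] A by measurable
  show "(\<lambda>x. indicator A x *\<^sub>R g x) \<in> borel_measurable lborel"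
    by (rule borel_measurable_LIMSEQ_real[OF lim meas])
  show "AE x in lborel. (\<lambda>n. indicator A x *\<^sub>R f n x) \<longlonglongrightarrow> indicator A x *\<^sub>R g x"
    using lim by simp
  show "AE x in lborel. norm (indicator A x *\<^sub>R f n x) \<le> indicator A x *\<^sub>R w x" for n
    using assms(4)[of _ n] by (intro AE_I2) (auto simp: indicator_def)
  show "integrable lborel (\<lambda>x. indicator A x *\<^sub>R w x)"
    using assms(1) by (simp add: set_integrable_def)
qed

text \<open>Dominated convergence is applied twice: in \<open>x\<close> with majorant
  \<open>G\<close>, then in \<open>t\<close> with the integral of \<open>G\<close>, a
  constant.\<close>

lemma mixed_int_tendsto:
  assumes dom: "\<And>n. dominated G (h n)"
    and lim: "\<And>t x. x \<in> {0<..<pi} \<Longrightarrow> (\<lambda>n. h n t x) \<longlonglongrightarrow> g t x"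
  shows "(\<lambda>n. mixed_int (h n)) \<longlonglongrightarrow> mixed_int g"
  unfolding mixed_int_def
proof (rule set_dominated_convergence[where w = "\<lambda>_. (LBINT x:{0<..<pi}. G x) * (1 / pi)"])
  show "set_integrable lborel {0..2*pi} (\<lambda>_. (LBINT x:{0<..<pi}. G x) * (1 / pi))"
    by (simp add: set_integrable_def)
  show "(\<lambda>t. (LBINT x:{0<..<pi}. h n t x) * (1 / pi)) \<in> borel_measurable lborel" for n
    using dominated_inner_measurable[OF dom] by measurable
  show "\<bar>(LBINT x:{0<..<pi}. h n t x) * (1 / pi)\<bar> \<le> (LBINT x:{0<..<pi}. G x) * (1 / pi)" for n t
    using dominated_inner_bound[OF dom, of n t] by (simp add: abs_mult divide_right_mono)
  show "(\<lambda>n. (LBINT x:{0<..<pi}. h n t x) * (1 / pi)) \<longlonglongrightarrow> (LBINT x:{0<..<pi}. g t x) * (1 / pi)" for t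
    by (intro tendsto_mult tendsto_const set_dominated_convergence[where w = G]
        dominated_integrable[OF dom] dominated_section_measurable[OF dom] dominated_bound[OF dom] lim) auto
qed simp

lemma mixed_int_add:
  assumes "dominated G h" "dominated G' h'"
  shows "mixed_int (\<lambda>t x. h t x + h' t x) = mixed_int h + mixed_int h'"
  unfolding mixed_int_def
  using dominated_section_integrable[OF assms(1)] dominated_section_integrable[OF assms(2)]
    dominated_outer_integrable[OF assms(1)] dominated_outer_integrable[OF assms(2)]
  by (simp only: set_integral_add distrib_right)

lemma mixed_int_cmult: "mixed_int (\<lambda>t x. k * h t x) = k * mixed_int h"
  unfolding mixed_int_def by (simp only: set_integral_mult_right mult.assoc)

lemma dominated_cmult:
  assumes "dominated G h"
  shows "dominated (\<lambda>x. \<bar>k\<bar> * G x) (\<lambda>t x. k * h t x)"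
  unfolding dominated_def
proof (intro conjI allI ballI)
  show "set_integrable lborel {0<..<pi} (\<lambda>x. \<bar>k\<bar> * G x)"
    using dominated_integrable[OF assms] by simp
  show "(\<lambda>(t, x). k * h t x) \<in> borel_measurable (lborel \<Otimes>\<^sub>M lborel)"
    using borel_measurable_times[OF borel_measurable_const[of k] dominated_measurable[OF assms]]
    by (simp add: case_prod_beta')
  show "\<bar>k * h t x\<bar> \<le> \<bar>k\<bar> * G x" if "x \<in> {0<..<pi}" for t x
    using dominated_bound[OF assms that, of t] by (simp add: abs_mult mult_left_mono)
qed

lemma dominated_add:
  assumes "dominated G h" "dominated G' h'"
  shows "dominated (\<lambda>x. G x + G' x) (\<lambda>t x. h t x + h' t x)"
  unfolding dominated_def
proof (intro conjI allI ballI)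
  show "set_integrable lborel {0<..<pi} (\<lambda>x. G x + G' x)"
    using assms[THEN dominated_integrable] by simp
  show "(\<lambda>(t, x). h t x + h' t x) \<in> borel_measurable (lborel \<Otimes>\<^sub>M lborel)"
    using borel_measurable_add[OF assms[THEN dominated_measurable]]
    by (simp add: case_prod_beta')
  show "\<bar>h t x + h' t x\<bar> \<le> G x + G' x" if "x \<in> {0<..<pi}" for t x
    using assms[THEN dominated_bound, OF that, of t]
    by (intro order_trans[OF abs_triangle_ineq] add_mono)
qed

lemma mixed_int_sum:
  assumes "finite I" "\<And>i. i \<in> I \<Longrightarrow> dominated (G i) (h i)"
  shows "mixed_int (\<lambda>t x. \<Sum>i\<in>I. k i * h i t x) = (\<Sum>i\<in>I. k i * mixed_int (h i))"
proof -
  \<comment> \<open>The induction also carries a majorant for the partial sum, which additivity of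
    \<open>mixed_int\<close> needs at the next step.\<close>
  have "mixed_int (\<lambda>t x. \<Sum>i\<in>I. k i * h i t x) = (\<Sum>i\<in>I. k i * mixed_int (h i))
      \<and> (\<exists>G'. dominated G' (\<lambda>t x. \<Sum>i\<in>I. k i * h i t x))"
    using assms
  proof (induction rule: finite_induct)
    case empty
    have "dominated (\<lambda>_. 0) (\<lambda>t x. 0)" by (simp add: dominated_def set_integrable_def)
    then show ?case by (auto simp: mixed_int_def)
  next
    case (insert i I)
    then obtain G' where G': "dominated G' (\<lambda>t x. \<Sum>i\<in>I. k i * h i t x)" by auto
    have i: "dominated (\<lambda>x. \<bar>k i\<bar> * G i x) (\<lambda>t x. k i * h i t x)"
      using insert by (intro dominated_cmult) auto
    from insert show ?case
      using mixed_int_add[OF i G'] dominated_add[OF i G'] by (auto simp: mixed_int_cmult)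
  qed
  then show ?thesis ..
qed

text \<open>A majorant with explicit primitive: \<open>?f\<close> is the derivative of
  \<open>?F\<close>, which has finite limits at both ends. Replacing \<open>cos x * cos x\<close> by
  \<open>1 - sin x * sin x\<close> loses at most \<open>1 + \<eta>\<close> against
  \<open>\<eta> * sin x powr (\<eta> - 1)\<close>, and the linear term of \<open>?F\<close> repays
  exactly this.\<close>

lemma set_integrable_sin_powr:
  assumes "0 < \<eta>"
  shows "set_integrable lborel {0<..<pi} (\<lambda>x. sin x powr (\<eta> - 1))"
proof -
  let ?F = "\<lambda>x. cos x * sin x powr \<eta> + (1 + \<eta>) * x"
  let ?f = "\<lambda>x. \<eta> * (sin x powr (\<eta> - 1)) * (cos x * cos x) + (1 + \<eta>) - sin x powr \<eta> * sin x"
  have Ioo: "einterval 0 (ereal pi) = {0<..<pi}"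
    by (auto simp: einterval_def zero_ereal_def)
  have le: "\<eta> * sin x powr (\<eta> - 1) \<le> ?f x" if "x \<in> {0<..<pi}" for x
  proof -
    have s: "0 < sin x" using that by (intro sin_gt_zero) auto
    have *: "sin x powr (\<eta> - 1) * (sin x * sin x) = sin x powr \<eta> * sin x"
      using s by (simp add: powr_diff)
    have "sin x powr \<eta> * sin x \<le> 1 * 1"
      using s assms by (intro mult_mono powr_le1) auto
    then have **: "(1 + \<eta>) * (sin x powr \<eta> * sin x) \<le> 1 + \<eta>"
      using assms by simp
    have cc: "cos x * cos x = 1 - sin x * sin x"
      using sin_cos_squared_add[of x] by (simp add: power2_eq_square)
    have "?f x = \<eta> * sin x powr (\<eta> - 1) - \<eta> * (sin x powr (\<eta> - 1) * (sin x * sin x))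
        + (1 + \<eta>) - sin x powr \<eta> * sin x"
      unfolding cc by (simp add: algebra_simps)
    also have "\<dots> = \<eta> * sin x powr (\<eta> - 1) + (1 + \<eta>) - (1 + \<eta>) * (sin x powr \<eta> * sin x)"
      unfolding * by (simp add: algebra_simps)
    finally show ?thesis using ** by linarith
  qed
  have "set_integrable lborel (einterval 0 (ereal pi)) ?f"
  proof (rule interval_integral_FTC_nonneg[where F = ?F and A = 0 and B = "(1 + \<eta>) * pi"])
    show "0 < ereal pi" by simp
    fix x assume x: "0 < ereal x" "ereal x < ereal pi"
    then have s: "0 < sin x" by (intro sin_gt_zero) auto
    show "DERIV ?F x :> ?f x"
      using s by (auto intro!: derivative_eq_intros simp: powr_diff field_simps)
    show "isCont ?f x"
      using s by (intro continuous_intros) auto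
  next
    show "AE x in lborel. 0 < ereal x \<longrightarrow> ereal x < ereal pi \<longrightarrow> 0 \<le> ?f x"
    proof (intro AE_I2 impI)
      fix x assume "0 < ereal x" "ereal x < ereal pi"
      then have "\<eta> * sin x powr (\<eta> - 1) \<le> ?f x" by (intro le) auto
      moreover have "0 \<le> \<eta> * sin x powr (\<eta> - 1)" using assms by simp
      ultimately show "0 \<le> ?f x" by linarith
    qed
    have "\<forall>\<^sub>F x in at_right (0::real). x \<in> {0<..<pi}"
      by (rule eventually_at_right_real) simp
    then have ev1: "\<forall>\<^sub>F x in at_right (0::real). 0 \<le> sin x"
      by eventually_elim (auto intro: sin_ge_zero)
    have "\<forall>\<^sub>F x in at_left pi. x \<in> {0<..<pi}"
      by (rule eventually_at_left_real) simp
    then have ev2: "\<forall>\<^sub>F x in at_left pi. 0 \<le> sin x"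
      by eventually_elim (auto intro: sin_ge_zero)
    \<comment> \<open>The base \<open>sin\<close> tends to 0 at both ends; convergence of
      \<open>powr\<close> there uses a positive exponent and an eventually nonnegative base.\<close>
    have lim: "(?F \<longlongrightarrow> cos z * sin z powr \<eta> + (1 + \<eta>) * z) (at z within S)"
      if "\<forall>\<^sub>F x in at z within S. 0 \<le> sin x" for z S
      by (intro tendsto_intros tendsto_powr2 that assms)
    show "((?F \<circ> real_of_ereal) \<longlongrightarrow> 0) (at_right 0)"
      unfolding zero_ereal_def ereal_tendsto_simps using lim[OF ev1] assms by simp
    show "((?F \<circ> real_of_ereal) \<longlongrightarrow> (1 + \<eta>) * pi) (at_left (ereal pi))"
      unfolding ereal_tendsto_simps using lim[OF ev2] assms by simp
  qed
  then have "set_integrable lborel {0<..<pi} ?f" unfolding Ioo .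
  then have "set_integrable lborel {0<..<pi} (\<lambda>x. \<eta> * sin x powr (\<eta> - 1))"
  proof (rule set_integrable_bound)
    show "set_borel_measurable lborel {0<..<pi} (\<lambda>x. \<eta> * sin x powr (\<eta> - 1))"
      by (simp add: set_borel_measurable_def)
    show "AE x in lborel. x \<in> {0<..<pi} \<longrightarrow> norm (\<eta> * sin x powr (\<eta> - 1)) \<le> norm (?f x)"
    proof (intro AE_I2 impI)
      fix x assume "x \<in> {0<..<pi}"
      then have "\<eta> * sin x powr (\<eta> - 1) \<le> ?f x" by (rule le)
      moreover have "0 \<le> \<eta> * sin x powr (\<eta> - 1)" using assms by simp
      ultimately show "norm (\<eta> * sin x powr (\<eta> - 1)) \<le> norm (?f x)"
        unfolding real_norm_def by linarith
    qed
  qed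
  then show ?thesis using assms by simp
qed

subsection \<open>Pairings of products with modes\<close>

lemma abs_eig_le: "\<bar>eig j x\<bar> \<le> freq j"
  using abs_sin_quotient_le[of "Suc j" x] by (simp add: eig_def freq_def add.commute)

lemma eig_sin: "x \<in> {0<..<pi} \<Longrightarrow> eig j x * sin x = sin (freq j * x)"
  using sin_gt_zero[of x] by (simp add: eig_def)

text \<open>Interpolates between \<open>\<bar>sin (freq j * x)\<bar> \<le> 1\<close> and
  \<open>\<bar>eig j x\<bar> \<le> freq j\<close>: a number in \<open>[0, 1]\<close> is at most its
  power of exponent \<open>\<eta>\<close>.\<close>

lemma abs_eig_sin_le:
  assumes "x \<in> {0<..<pi}" "0 \<le> \<eta>" "\<eta> \<le> 1"
  shows "\<bar>eig j x\<bar> * sin x \<le> freq j powr \<eta> * sin x powr \<eta>"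
proof -
  have s: "0 < sin x" using assms by (intro sin_gt_zero) auto
  let ?y = "\<bar>eig j x\<bar> * sin x"
  have "?y = \<bar>eig j x * sin x\<bar>" using s by (simp add: abs_mult)
  then have y1: "?y \<le> 1" using eig_sin[OF assms(1)] by simp
  have "?y \<le> freq j * sin x" using s by (intro mult_right_mono abs_eig_le) auto
  have y0: "0 \<le> ?y" using s by simp
  have "?y \<le> ?y powr \<eta>"
  proof (cases "?y = 0")
    case False
    then have "?y powr 1 \<le> ?y powr \<eta>" using y0 y1 assms by (intro powr_mono') auto
    then show ?thesis using y0 False by simp
  qed (use powr_ge_zero[of ?y \<eta>] in linarith)
  also have "\<dots> \<le> (freq j * sin x) powr \<eta>"
    using \<open>?y \<le> freq j * sin x\<close> y0 assms by (intro powr_mono2) auto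
  also have "\<dots> = freq j powr \<eta> * sin x powr \<eta>"
    using s freq_pos[of j] by (simp add: powr_mult)
  finally show ?thesis .
qed

lemma eig_measurable [measurable]: "eig j \<in> borel_measurable borel"
  unfolding eig_def by measurable

lemma V_fun_measurable [measurable]:
  "case_prod (V_fun c) \<in> borel_measurable (lborel \<Otimes>\<^sub>M lborel)"
  unfolding V_fun_def by measurable

text \<open>Multiplication by \<open>sin x\<close> removes the singular denominator of
  \<open>eig\<close>; spending \<open>\<eta>\<close> powers of the frequency buys the decay
  \<open>sin x powr \<eta>\<close> at the endpoints.\<close>

lemma V_fun_bound:
  assumes c: "summable (\<lambda>j. \<bar>c j\<bar> * freq j powr \<eta>)" and x: "x \<in> {0<..<pi}" and \<eta>: "0 \<le> \<eta>" "\<eta> \<le> 1"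
  shows "summable (\<lambda>j. \<bar>c j * cos (freq j * t) * eig j x\<bar>)"
    and "\<bar>V_fun c t x\<bar> * sin x \<le> (\<Sum>j. \<bar>c j\<bar> * freq j powr \<eta>) * sin x powr \<eta>"
proof -
  have s: "0 < sin x" using x by (intro sin_gt_zero) auto
  have le: "\<bar>c j * cos (freq j * t) * eig j x\<bar> * sin x \<le> \<bar>c j\<bar> * freq j powr \<eta> * sin x powr \<eta>" for j
  proof -
    have "\<bar>c j * cos (freq j * t) * eig j x\<bar> * sin x = (\<bar>c j\<bar> * \<bar>cos (freq j * t)\<bar>) * (\<bar>eig j x\<bar> * sin x)"
      by (simp add: abs_mult)
    also have "\<dots> \<le> (\<bar>c j\<bar> * 1) * (freq j powr \<eta> * sin x powr \<eta>)"
      using s x \<eta> by (intro mult_mono mult_left_mono abs_eig_sin_le) auto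
    finally show ?thesis by simp
  qed
  have "summable (\<lambda>j. \<bar>c j * cos (freq j * t) * eig j x\<bar> * sin x)"
    by (rule summable_comparison_test'[where N = 0 and g = "\<lambda>j. \<bar>c j\<bar> * freq j powr \<eta> * sin x powr \<eta>"])
      (use le s c in \<open>auto intro: summable_mult2 simp: abs_mult\<close>)
  then show sm: "summable (\<lambda>j. \<bar>c j * cos (freq j * t) * eig j x\<bar>)"
    using summable_divide[of _ "sin x"] s by fastforce
  have "\<bar>V_fun c t x\<bar> * sin x \<le> (\<Sum>j. \<bar>c j * cos (freq j * t) * eig j x\<bar>) * sin x"
    unfolding V_fun_def using s by (intro mult_right_mono summable_rabs sm) auto
  also have "\<dots> = (\<Sum>j. \<bar>c j * cos (freq j * t) * eig j x\<bar> * sin x)"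
    using sm by (rule suminf_mult2)
  also have "\<dots> \<le> (\<Sum>j. \<bar>c j\<bar> * freq j powr \<eta> * sin x powr \<eta>)"
    using le sm c by (intro suminf_le summable_mult2)
  also have "\<dots> = (\<Sum>j. \<bar>c j\<bar> * freq j powr \<eta>) * sin x powr \<eta>"
    using c by (rule suminf_mult2[symmetric])
  finally show "\<bar>V_fun c t x\<bar> * sin x \<le> (\<Sum>j. \<bar>c j\<bar> * freq j powr \<eta>) * sin x powr \<eta>" .
qed

lemma V_fun_sin_le:
  assumes c: "summable (\<lambda>j. \<bar>c j\<bar>)" and x: "x \<in> {0<..<pi}"
  shows "\<bar>V_fun c t x\<bar> * sin x \<le> (\<Sum>j. \<bar>c j\<bar>)"
proof -
  have "freq j powr 0 = 1" for j by simp
  moreover have "sin x powr 0 = 1" using sin_gt_zero[of x] x by simp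
  ultimately show ?thesis using V_fun_bound(2)[of c 0 x t] c x by simp
qed

section \<open>Truncation to finitely many modes\<close>

definition trunc :: "nat \<Rightarrow> (nat \<Rightarrow> real) \<Rightarrow> nat \<Rightarrow> real" where
  "trunc N c j = (if j < N then c j else 0)"

lemma V_fun_trunc: "V_fun (trunc N c) t x = (\<Sum>j<N. c j * (cos (freq j * t) * eig j x))"
proof -
  have "V_fun (trunc N c) t x = (\<Sum>j<N. trunc N c j * cos (freq j * t) * eig j x)"
    unfolding V_fun_def by (rule suminf_finite) (auto simp: trunc_def)
  then show ?thesis by (simp add: trunc_def mult.assoc)
qed

lemma V_fun_trunc_tendsto:
  assumes c: "summable (\<lambda>j. \<bar>c j\<bar>)" and x: "x \<in> {0<..<pi}"
  shows "(\<lambda>N. V_fun (trunc N c) t x) \<longlonglongrightarrow> V_fun c t x"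
proof -
  have "summable (\<lambda>j. \<bar>c j * cos (freq j * t) * eig j x\<bar>)"
    using V_fun_bound(1)[of c 0 x t] c x by simp
  then have "summable (\<lambda>j. c j * cos (freq j * t) * eig j x)"
    by (rule summable_rabs_cancel)
  from summable_LIMSEQ[OF this] show ?thesis
    unfolding V_fun_trunc unfolding V_fun_def by (simp add: mult.assoc)
qed

lemma trunc_summable: "summable (\<lambda>j. \<bar>trunc N c j\<bar>)"
  by (rule summable_finite[of "{..<N}"]) (auto simp: trunc_def)

lemma trunc_suminf_le:
  assumes "summable (\<lambda>j. \<bar>c j\<bar>)"
  shows "(\<Sum>j. \<bar>trunc N c j\<bar>) \<le> (\<Sum>j. \<bar>c j\<bar>)"
  using assms by (intro suminf_le trunc_summable) (auto simp: trunc_def)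

definition mode :: "nat \<Rightarrow> nat \<Rightarrow> real \<Rightarrow> real \<Rightarrow> real" where
  "mode l j t x = cos (real l * t) * eig j x"

lemma mode_measurable [measurable]: "case_prod (mode l j) \<in> borel_measurable (lborel \<Otimes>\<^sub>M lborel)"
  unfolding mode_def by measurable

definition mode_pairing :: "(nat \<Rightarrow> real) \<Rightarrow> (nat \<Rightarrow> real) \<Rightarrow> nat \<Rightarrow> nat \<Rightarrow> real" where
  "mode_pairing c d l j = pairing (\<lambda>t x. V_fun c t x * V_fun d t x) (mode l j)"

lemma dominated_const:
  assumes "case_prod h \<in> borel_measurable (lborel \<Otimes>\<^sub>M lborel)"
    "\<And>t x. x \<in> {0<..<pi} \<Longrightarrow> \<bar>h t x\<bar> \<le> B"
  shows "dominated (\<lambda>_. B) h"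
  using assms by (auto simp: dominated_def set_integrable_def)

text \<open>The weight \<open>(sin x)\<^sup>2\<close> gives one sine to each of the two functions,
  and the mode is bounded by \<open>freq j\<close>. Upper bounds \<open>Bc\<close>,
  \<open>Bd\<close> in place of the exact sums let one majorant serve all truncations.\<close>

lemma dominated_mode:
  assumes c: "summable (\<lambda>j. \<bar>c j\<bar>)" "(\<Sum>j. \<bar>c j\<bar>) \<le> Bc"
    and d: "summable (\<lambda>j. \<bar>d j\<bar>)" "(\<Sum>j. \<bar>d j\<bar>) \<le> Bd"
  shows "dominated (\<lambda>_. Bc * Bd * freq j * (2 / pi))
    (\<lambda>t x. V_fun c t x * V_fun d t x * mode l j t x * (sin x)\<^sup>2 * (2 / pi))"
proof (rule dominated_const)
  show "(\<lambda>(t, x). V_fun c t x * V_fun d t x * mode l j t x * (sin x)\<^sup>2 * (2 / pi))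
      \<in> borel_measurable (lborel \<Otimes>\<^sub>M lborel)"
    by measurable
  fix t x :: real assume x: "x \<in> {0<..<pi}"
  then have s: "0 < sin x" by (intro sin_gt_zero) auto
  have m: "\<bar>mode l j t x\<bar> \<le> 1 * freq j"
    unfolding mode_def abs_mult by (intro mult_mono abs_eig_le) auto
  have "\<bar>V_fun c t x * V_fun d t x * mode l j t x * (sin x)\<^sup>2 * (2 / pi)\<bar>
      = (\<bar>V_fun c t x\<bar> * sin x) * (\<bar>V_fun d t x\<bar> * sin x) * \<bar>mode l j t x\<bar> * (2 / pi)"
    using s by (simp add: abs_mult power2_eq_square)
  also have "\<dots> \<le> Bc * Bd * (1 * freq j) * (2 / pi)"
    using s V_fun_sin_le[OF c(1) x, of t] V_fun_sin_le[OF d(1) x, of t] c(2) d(2) m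
      suminf_nonneg[OF c(1)] suminf_nonneg[OF d(1)]
    by (intro mult_mono mult_right_mono mult_nonneg_nonneg) (auto intro: order_trans)
  finally show "\<bar>V_fun c t x * V_fun d t x * mode l j t x * (sin x)\<^sup>2 * (2 / pi)\<bar>
      \<le> Bc * Bd * freq j * (2 / pi)" by simp
qed

lemma mode_pairing_trunc_tendsto:
  assumes c: "summable (\<lambda>j. \<bar>c j\<bar>)" and d: "summable (\<lambda>j. \<bar>d j\<bar>)"
  shows "(\<lambda>N. mode_pairing (trunc N c) (trunc N d) l j) \<longlonglongrightarrow> mode_pairing c d l j"
  unfolding mode_pairing_def pairing_eq_mixed_int
proof (rule mixed_int_tendsto)
  show "dominated (\<lambda>_. (\<Sum>j. \<bar>c j\<bar>) * (\<Sum>j. \<bar>d j\<bar>) * freq j * (2 / pi))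
      (\<lambda>t x. V_fun (trunc N c) t x * V_fun (trunc N d) t x * mode l j t x * (sin x)\<^sup>2 * (2 / pi))" for N
    using c d by (intro dominated_mode trunc_summable trunc_suminf_le)
  show "(\<lambda>N. V_fun (trunc N c) t x * V_fun (trunc N d) t x * mode l j t x * (sin x)\<^sup>2 * (2 / pi))
      \<longlonglongrightarrow> V_fun c t x * V_fun d t x * mode l j t x * (sin x)\<^sup>2 * (2 / pi)"
    if "x \<in> {0<..<pi}" for t x
    by (intro tendsto_mult tendsto_const V_fun_trunc_tendsto c d that)
qed

text \<open>Time and space separate. Normalised by \<open>2 / pi\<close>, the spatial factor is 0 or
  1 by the Clebsch-Gordan rule, so only the time resonance remains and the bound is uniform in
  \<open>j\<close>.\<close>

lemma mode_triple_bound: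
  "\<bar>mixed_int (\<lambda>t x. cos (freq a * t) * eig a x * (cos (freq b * t) * eig b x) * mode l j t x
      * (sin x)\<^sup>2 * (2 / pi))\<bar> \<le> 2 * chi l a b"
proof -
  let ?T = "\<lambda>t. cos (freq a * t) * cos (freq b * t) * cos (real l * t)"
  let ?X = "\<lambda>x. eig a x * eig b x * eig j x * (sin x)\<^sup>2 * (2 / pi)"
  have "mixed_int (\<lambda>t x. cos (freq a * t) * eig a x * (cos (freq b * t) * eig b x) * mode l j t x
      * (sin x)\<^sup>2 * (2 / pi)) = mixed_int (\<lambda>t x. ?T t * ?X x)"
    by (simp add: mode_def mult_ac)
  also have "\<dots> = (LBINT t:{0..2*pi}. ?T t * ((LBINT x:{0<..<pi}. ?X x) * (1 / pi)))"
    unfolding mixed_int_def by (simp only: set_integral_mult_right mult.assoc)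
  also have "\<dots> = (LBINT t:{0..2*pi}. ?T t) * (1 / pi) * (LBINT x:{0<..<pi}. ?X x)"
    by (simp only: set_integral_mult_left) simp
  also have "(LBINT x:{0<..<pi}. ?X x) = (LBINT x:{0<..<pi}.
      sin (real (Suc a) * x) * sin (real (Suc b) * x) * (sin (real (Suc j) * x) / sin x) * (2 / pi))"
  proof (intro set_lebesgue_integral_cong ballI allI impI)
    fix x assume "x \<in> {0<..<pi}"
    then have "0 < sin x" by (intro sin_gt_zero) auto
    then show "?X x = sin (real (Suc a) * x) * sin (real (Suc b) * x) * (sin (real (Suc j) * x) / sin x) * (2 / pi)"
      by (simp add: eig_def freq_def power2_eq_square add.commute)
  qed simp
  also have "\<dots> = of_bool (clebsch (Suc a) (Suc b) (Suc j))"
    by (simp only: set_integral_mult_left integral_sin_sin_sin_quotient zero_less_Suc) simp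
  finally show ?thesis
    using time_integral_bound[of a b l] chi_nonneg[of l a b] by (auto simp: abs_mult)
qed

text \<open>Up to a factor 2, a majorant independent of \<open>j\<close> for all coefficients of the
  truncated product at time frequency \<open>l\<close>.\<close>

definition conv_sum :: "nat \<Rightarrow> (nat \<Rightarrow> real) \<Rightarrow> (nat \<Rightarrow> real) \<Rightarrow> nat \<Rightarrow> real" where
  "conv_sum N c d l = (\<Sum>a<N. \<Sum>b<N. \<bar>c a\<bar> * \<bar>d b\<bar> * chi l a b)"

lemma mode_pairing_trunc_bound:
  "\<bar>mode_pairing (trunc N c) (trunc N d) l j\<bar> \<le> 2 * conv_sum N c d l"
proof -
  let ?I = "{..<N} \<times> {..<N}"
  let ?h = "\<lambda>i t x. cos (freq (fst i) * t) * eig (fst i) x * (cos (freq (snd i) * t) * eig (snd i) x)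
    * mode l j t x * (sin x)\<^sup>2 * (2 / pi)"
  have "mode_pairing (trunc N c) (trunc N d) l j
      = mixed_int (\<lambda>t x. \<Sum>i\<in>?I. (c (fst i) * d (snd i)) * ?h i t x)"
    unfolding mode_pairing_def pairing_eq_mixed_int V_fun_trunc
    unfolding sum_product sum.cartesian_product
    unfolding sum_distrib_right case_prod_beta by (simp only: mult_ac)
  also have "\<dots> = (\<Sum>i\<in>?I. (c (fst i) * d (snd i)) * mixed_int (?h i))"
  proof (rule mixed_int_sum[where G = "\<lambda>i _. freq (fst i) * freq (snd i) * freq j * (2 / pi)"])
    fix i
    show "dominated (\<lambda>_. freq (fst i) * freq (snd i) * freq j * (2 / pi)) (?h i)"
    proof (rule dominated_const)
      show "case_prod (?h i) \<in> borel_measurable (lborel \<Otimes>\<^sub>M lborel)" by measurable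
      show "\<bar>?h i t x\<bar> \<le> freq (fst i) * freq (snd i) * freq j * (2 / pi)" for t x
      proof -
        have "\<bar>?h i t x\<bar> \<le> (1 * freq (fst i)) * (1 * freq (snd i)) * (1 * freq j) * 1 * (2 / pi)"
          unfolding abs_mult mode_def using freq_pos
          by (intro mult_mono abs_eig_le mult_nonneg_nonneg)
            (auto simp: less_imp_le power_le_one abs_square_le_1)
        then show ?thesis by simp
      qed
    qed
  qed simp
  finally have "\<bar>mode_pairing (trunc N c) (trunc N d) l j\<bar>
      = \<bar>\<Sum>i\<in>?I. (c (fst i) * d (snd i)) * mixed_int (?h i)\<bar>"
    by (rule arg_cong)
  also have "\<dots> \<le> (\<Sum>i\<in>?I. \<bar>c (fst i)\<bar> * \<bar>d (snd i)\<bar> * (2 * chi l (fst i) (snd i)))"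
  proof (rule order_trans[OF sum_abs], rule sum_mono)
    fix i
    have "\<bar>c (fst i) * d (snd i) * mixed_int (?h i)\<bar> = \<bar>c (fst i)\<bar> * \<bar>d (snd i)\<bar> * \<bar>mixed_int (?h i)\<bar>"
      by (simp only: abs_mult)
    also have "\<dots> \<le> \<bar>c (fst i)\<bar> * \<bar>d (snd i)\<bar> * (2 * chi l (fst i) (snd i))"
      by (rule mult_left_mono[OF mode_triple_bound]) simp
    finally show "\<bar>c (fst i) * d (snd i) * mixed_int (?h i)\<bar>
        \<le> \<bar>c (fst i)\<bar> * \<bar>d (snd i)\<bar> * (2 * chi l (fst i) (snd i))" .
  qed
  also have "\<dots> = 2 * conv_sum N c d l"
    unfolding conv_sum_def sum_distrib_left sum.cartesian_product
    by (intro sum.cong) auto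
  finally show ?thesis .
qed

lemma conv_sum_nonneg: "0 \<le> conv_sum N c d l"
  by (simp add: conv_sum_def sum_nonneg chi_nonneg)

lemma sum_conv_sum_le:
  "(\<Sum>l<n. conv_sum N c d l) \<le> 2 * (\<Sum>a<N. \<bar>c a\<bar>) * (\<Sum>b<N. \<bar>d b\<bar>)"
proof -
  have "(\<Sum>l<n. conv_sum N c d l)
      = (\<Sum>l<n. \<Sum>i\<in>{..<N}\<times>{..<N}. \<bar>c (fst i)\<bar> * \<bar>d (snd i)\<bar> * chi l (fst i) (snd i))"
    unfolding conv_sum_def sum.cartesian_product by (simp add: case_prod_beta)
  also have "\<dots> = (\<Sum>i\<in>{..<N}\<times>{..<N}. \<bar>c (fst i)\<bar> * \<bar>d (snd i)\<bar> * (\<Sum>l<n. chi l (fst i) (snd i)))"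
    unfolding sum_distrib_left by (rule sum.swap)
  also have "\<dots> \<le> (\<Sum>i\<in>{..<N}\<times>{..<N}. \<bar>c (fst i)\<bar> * \<bar>d (snd i)\<bar> * 2)"
    by (intro sum_mono mult_left_mono sum_chi_freq_le) auto
  also have "\<dots> = 2 * (\<Sum>a<N. \<bar>c a\<bar>) * (\<Sum>b<N. \<bar>d b\<bar>)"
    by (simp add: sum_product sum.cartesian_product case_prod_beta sum_distrib_left mult_ac)
  finally show ?thesis .
qed

lemma sum_conv_sum_mult:
  "(\<Sum>l<n. conv_sum N c d l * conv_sum N e f l)
    = quad_sum n N (\<lambda>a. \<bar>c a\<bar>) (\<lambda>b. \<bar>d b\<bar>) (\<lambda>p. \<bar>e p\<bar>) (\<lambda>q. \<bar>f q\<bar>)"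
proof -
  let ?I = "{..<N} \<times> {..<N}"
  have "(\<Sum>l<n. conv_sum N c d l * conv_sum N e f l)
      = (\<Sum>l<n. \<Sum>i\<in>?I. \<Sum>i'\<in>?I. (\<bar>c (fst i)\<bar> * \<bar>d (snd i)\<bar> * chi l (fst i) (snd i))
          * (\<bar>e (fst i')\<bar> * \<bar>f (snd i')\<bar> * chi l (fst i') (snd i')))"
    unfolding conv_sum_def sum.cartesian_product sum_product by (simp add: case_prod_beta)
  \<comment> \<open>The swaps carry the sum over \<open>l\<close> innermost, where it forms
    \<open>quad_kernel\<close>, and put the second pair outermost as in
    \<open>quad_sum\<close>.\<close>
  also have "\<dots> = (\<Sum>i'\<in>?I. \<Sum>i\<in>?I. \<Sum>l<n. (\<bar>c (fst i)\<bar> * \<bar>d (snd i)\<bar> * chi l (fst i) (snd i))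
          * (\<bar>e (fst i')\<bar> * \<bar>f (snd i')\<bar> * chi l (fst i') (snd i')))"
    by (subst sum.swap, subst (2) sum.swap, subst sum.swap) (rule refl)
  also have "\<dots> = (\<Sum>i'\<in>?I. \<Sum>i\<in>?I. \<bar>c (fst i)\<bar> * \<bar>d (snd i)\<bar> * \<bar>e (fst i')\<bar> * \<bar>f (snd i')\<bar>
        * quad_kernel n (fst i) (snd i) (fst i') (snd i'))"
    unfolding quad_kernel_def sum_distrib_left by (intro sum.cong refl) (simp only: mult_ac)
  also have "\<dots> = quad_sum n N (\<lambda>a. \<bar>c a\<bar>) (\<lambda>b. \<bar>d b\<bar>) (\<lambda>p. \<bar>e p\<bar>) (\<lambda>q. \<bar>f q\<bar>)"
    by (simp add: quad_sum_def sum.cartesian_product')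
  finally show ?thesis .
qed

subsection \<open>The quartic form\<close>

definition offres :: "nat \<Rightarrow> (nat \<times> nat) set" where
  "offres n = (SIGMA l:{..<n}. {j\<in>{..<n}. real l \<noteq> freq j})"

lemma finite_offres [simp]: "finite (offres n)"
  by (simp add: offres_def)

lemma offres_subset: "offres n \<subseteq> {(l, j). real l \<noteq> freq j}"
  by (auto simp: offres_def)

lemma offres_cover:
  assumes "finite X" "X \<subseteq> {(l, j). real l \<noteq> freq j}"
  shows "\<exists>n0. \<forall>n\<ge>n0. X \<subseteq> offres n"
proof -
  have "finite (fst ` X \<union> snd ` X)" using assms by simp
  then obtain n0 where "fst ` X \<union> snd ` X \<subseteq> {..<n0}"
    using finite_nat_iff_bounded by auto
  then have "X \<subseteq> offres n" if "n \<ge> n0" for n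
    using assms(2) that by (force simp: offres_def)
  then show ?thesis by blast
qed

text \<open>The squares \<open>offres n\<close> eventually contain every finite off-resonant set, so
  an unconditional sum can be evaluated along them as the limit of a sequence.\<close>

lemma filterlim_offres:
  "filterlim offres (finite_subsets_at_top {(l, j). real l \<noteq> freq j}) sequentially"
  unfolding filterlim_finite_subsets_at_top eventually_sequentially
  using offres_cover offres_subset by (auto simp del: split_paired_All)

lemma sum_offres_le:
  assumes "resolvent_bound \<omega> K" "\<And>l. 0 \<le> g l"
  shows "(\<Sum>i\<in>offres n. g (fst i) * (1 / \<bar>\<omega>\<^sup>2 * (real (fst i))\<^sup>2 - (freq (snd i))\<^sup>2\<bar>))
    \<le> K * (\<Sum>l<n. g l)"
proof -
  have "(\<Sum>i\<in>offres n. g (fst i) * (1 / \<bar>\<omega>\<^sup>2 * (real (fst i))\<^sup>2 - (freq (snd i))\<^sup>2\<bar>))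
      = (\<Sum>l<n. \<Sum>j\<in>{j\<in>{..<n}. real l \<noteq> freq j}. g l * (1 / \<bar>\<omega>\<^sup>2 * (real l)\<^sup>2 - (freq j)\<^sup>2\<bar>))"
    unfolding offres_def by (subst sum.Sigma) (auto simp: case_prod_beta)
  also have "\<dots> = (\<Sum>l<n. g l * (\<Sum>j\<in>{j\<in>{..<n}. real l \<noteq> freq j}. 1 / \<bar>\<omega>\<^sup>2 * (real l)\<^sup>2 - (freq j)\<^sup>2\<bar>))"
    by (simp only: sum_distrib_left)
  also have "\<dots> \<le> (\<Sum>l<n. g l * K)"
    by (intro sum_mono mult_left_mono assms(1)[unfolded resolvent_bound_def, rule_format]
        assms(2) finite_lessThan)
  finally show ?thesis by (simp add: sum_distrib_left mult.commute)
qed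

lemma resolvent_bound_nonneg:
  assumes "resolvent_bound \<omega> K"
  shows "0 \<le> K"
  using spec[OF spec[OF assms[unfolded resolvent_bound_def], of 0], of "{}"] by simp

text \<open>Two limits are taken in turn: on a fixed square \<open>offres n\<close> the sequences
  are truncated at \<open>N\<close> and \<open>N\<close> tends to infinity, then \<open>n\<close>
  does. The estimates are uniform in both; the 4 is the product of the factors 2 in the coefficient
  bounds of the two products.\<close>

lemma quartic_le:
  assumes \<delta>: "0 < \<delta>" and V: "c1 \<in> V_space (1/2 + \<delta>)" "c2 \<in> V_space (1/2 + \<delta>)"
      "c3 \<in> V_space (1/2 + \<delta>)" "c4 \<in> V_space (1/2 + \<delta>)"
    and K: "resolvent_bound \<omega> K"
    and Q: "\<And>n N. quad_sum n N (\<lambda>a. \<bar>c1 a\<bar>) (\<lambda>b. \<bar>c2 b\<bar>) (\<lambda>p. \<bar>c3 p\<bar>) (\<lambda>q. \<bar>c4 q\<bar>) \<le> B"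
  shows "\<bar>quartic \<omega> c1 c2 c3 c4\<bar> \<le> 4 * K * B"
proof -
  let ?S = "{(l, j). real l \<noteq> freq j}"
  note l1 = l1_summable[OF V(1) \<delta>] l1_summable[OF V(2) \<delta>] l1_summable[OF V(3) \<delta>] l1_summable[OF V(4) \<delta>]
  define d where "d i = \<omega>\<^sup>2 * (real (fst i))\<^sup>2 - (freq (snd i))\<^sup>2" for i :: "nat \<times> nat"
  define w where "w t x = V_fun c3 t x * V_fun c4 t x" for t x
  define u where "u t x = V_fun c1 t x * V_fun c2 t x" for t x
  \<comment> \<open>The normalisation of the mode \<open>l = 0\<close> in \<open>tx_coeff\<close>;
    being at most 1, it drops out of the bounds.\<close>
  define \<epsilon> :: "nat \<Rightarrow> real" where "\<epsilon> l = (if l = 0 then 1/2 else 1)" for l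
  define T where "T i = \<epsilon> (fst i) * mode_pairing c3 c4 (fst i) (snd i)" for i
  define Tt where "Tt N i = \<epsilon> (fst i) * mode_pairing (trunc N c3) (trunc N c4) (fst i) (snd i)" for N i
  define U where "U i = mode_pairing c1 c2 (fst i) (snd i)" for i
  define Ut where "Ut N i = mode_pairing (trunc N c1) (trunc N c2) (fst i) (snd i)" for N i
  \<comment> \<open>Bounds the \<open>l^1\<close> norm of the coefficients of \<open>L_inv\<close>:
    2 from the coefficient bound, 2 from the time frequencies resonant with a pair, \<open>K\<close>
    from the sum over \<open>j\<close>.\<close>
  define M where "M = 4 * K * ((\<Sum>j. \<bar>c3 j\<bar>) * (\<Sum>j. \<bar>c4 j\<bar>))"
  have K0: "0 \<le> K" by (rule resolvent_bound_nonneg[OF K])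
  have Tt_lim: "(\<lambda>N. Tt N i) \<longlonglongrightarrow> T i" for i
    unfolding T_def Tt_def by (intro tendsto_intros mode_pairing_trunc_tendsto l1)
  have Ut_lim: "(\<lambda>N. Ut N i) \<longlonglongrightarrow> U i" for i
    unfolding U_def Ut_def by (intro mode_pairing_trunc_tendsto l1)
  have Tt_le: "\<bar>Tt N i\<bar> \<le> 2 * conv_sum N c3 c4 (fst i)" for N i
  proof -
    have "\<bar>Tt N i\<bar> \<le> 1 * \<bar>mode_pairing (trunc N c3) (trunc N c4) (fst i) (snd i)\<bar>"
      unfolding Tt_def abs_mult by (intro mult_right_mono) (auto simp: \<epsilon>_def)
    then show ?thesis using mode_pairing_trunc_bound[of N c3 c4 "fst i" "snd i"] by simp
  qed
  have Ut_le: "\<bar>Ut N i\<bar> \<le> 2 * conv_sum N c1 c2 (fst i)" for N i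
    unfolding Ut_def by (rule mode_pairing_trunc_bound)
  \<comment> \<open>This serves twice: for the convergence of the series defining
    \<open>L_inv\<close> and for the majorant of its partial sums.\<close>
  have coeff_sum: "(\<Sum>i\<in>offres n. \<bar>T i / d i\<bar>) \<le> M" for n
  proof (rule LIMSEQ_le_const2)
    show "(\<lambda>N. \<Sum>i\<in>offres n. \<bar>Tt N i\<bar> * (1 / \<bar>d i\<bar>)) \<longlonglongrightarrow> (\<Sum>i\<in>offres n. \<bar>T i / d i\<bar>)"
      unfolding abs_divide divide_inverse[of "\<bar>T _\<bar>"] inverse_eq_divide
      by (intro tendsto_sum tendsto_mult tendsto_const tendsto_rabs Tt_lim)
    show "\<exists>N0. \<forall>N\<ge>N0. (\<Sum>i\<in>offres n. \<bar>Tt N i\<bar> * (1 / \<bar>d i\<bar>)) \<le> M"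
    proof (intro exI allI impI)
      fix N
      have "(\<Sum>i\<in>offres n. \<bar>Tt N i\<bar> * (1 / \<bar>d i\<bar>))
          \<le> (\<Sum>i\<in>offres n. (2 * conv_sum N c3 c4 (fst i)) * (1 / \<bar>d i\<bar>))"
        by (intro sum_mono mult_right_mono Tt_le) auto
      also have "\<dots> \<le> K * (\<Sum>l<n. 2 * conv_sum N c3 c4 l)"
        unfolding d_def by (rule sum_offres_le[OF K]) (simp add: conv_sum_nonneg)
      also have "\<dots> = 2 * K * (\<Sum>l<n. conv_sum N c3 c4 l)"
        by (simp add: sum_distrib_left mult_ac)
      also have "\<dots> \<le> 2 * K * (2 * (\<Sum>a<N. \<bar>c3 a\<bar>) * (\<Sum>b<N. \<bar>c4 b\<bar>))"
        using K0 by (intro mult_left_mono sum_conv_sum_le) auto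
      also have "\<dots> = 4 * K * ((\<Sum>a<N. \<bar>c3 a\<bar>) * (\<Sum>b<N. \<bar>c4 b\<bar>))" by simp
      also have "\<dots> \<le> M"
        unfolding M_def using K0 l1
        by (intro mult_left_mono mult_mono sum_le_suminf suminf_nonneg) (auto intro: sum_nonneg)
      finally show "(\<Sum>i\<in>offres n. \<bar>Tt N i\<bar> * (1 / \<bar>d i\<bar>)) \<le> M" .
    qed
  qed
  \<comment> \<open>The sum over \<open>j\<close> costs \<open>K\<close>; what remains is a sum over
    \<open>l\<close> of a product of two \<open>conv_sum\<close> terms, which is a
    \<open>quad_sum\<close>.\<close>
  have pair_sum: "\<bar>\<Sum>i\<in>offres n. T i / d i * U i\<bar> \<le> 4 * K * B" for n
  proof (rule LIMSEQ_le_const2)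
    show "(\<lambda>N. \<bar>\<Sum>i\<in>offres n. Tt N i * (1 / d i) * Ut N i\<bar>) \<longlonglongrightarrow> \<bar>\<Sum>i\<in>offres n. T i / d i * U i\<bar>"
      unfolding divide_inverse[of "T _"] inverse_eq_divide
      by (intro tendsto_rabs tendsto_sum tendsto_mult tendsto_const Tt_lim Ut_lim)
    show "\<exists>N0. \<forall>N\<ge>N0. \<bar>\<Sum>i\<in>offres n. Tt N i * (1 / d i) * Ut N i\<bar> \<le> 4 * K * B"
    proof (intro exI allI impI)
      fix N
      have "\<bar>\<Sum>i\<in>offres n. Tt N i * (1 / d i) * Ut N i\<bar>
          \<le> (\<Sum>i\<in>offres n. \<bar>Tt N i\<bar> * (1 / \<bar>d i\<bar>) * \<bar>Ut N i\<bar>)"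
        by (rule order_trans[OF sum_abs]) (simp add: abs_mult)
      also have "\<dots> \<le> (\<Sum>i\<in>offres n. (2 * conv_sum N c3 c4 (fst i)) * (1 / \<bar>d i\<bar>) * (2 * conv_sum N c1 c2 (fst i)))"
        by (intro sum_mono mult_mono Tt_le Ut_le order_refl mult_nonneg_nonneg)
          (auto simp: conv_sum_nonneg)
      also have "\<dots> = (\<Sum>i\<in>offres n. (4 * (conv_sum N c1 c2 (fst i) * conv_sum N c3 c4 (fst i))) * (1 / \<bar>d i\<bar>))"
        by (simp add: mult_ac)
      also have "\<dots> \<le> K * (\<Sum>l<n. 4 * (conv_sum N c1 c2 l * conv_sum N c3 c4 l))"
        unfolding d_def by (rule sum_offres_le[OF K]) (simp add: conv_sum_nonneg)
      also have "\<dots> = 4 * K * (\<Sum>l<n. conv_sum N c1 c2 l * conv_sum N c3 c4 l)"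
        by (simp add: sum_distrib_left mult_ac)
      also have "\<dots> \<le> 4 * K * B"
        unfolding sum_conv_sum_mult using K0 by (intro mult_left_mono Q) auto
      finally show "\<bar>\<Sum>i\<in>offres n. Tt N i * (1 / d i) * Ut N i\<bar> \<le> 4 * K * B" .
    qed
  qed
  define L where "L n t x = (\<Sum>i\<in>offres n. T i / d i * mode (fst i) (snd i) t x)" for n t x
  have L_inv_eq: "L_inv \<omega> w t x = (\<Sum>\<^sub>\<infinity>i\<in>?S. T i / d i * mode (fst i) (snd i) t x)" for t x
    unfolding L_inv_def tx_coeff_def T_def \<epsilon>_def d_def mode_pairing_def w_def mode_def[abs_def]
    by (intro infsum_cong) auto
  have mode_sin: "\<bar>mode l j t x\<bar> * sin x \<le> 1" if "x \<in> {0<..<pi}" for l j t x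
  proof -
    have "\<bar>mode l j t x\<bar> * sin x = \<bar>cos (real l * t)\<bar> * (\<bar>eig j x\<bar> * sin x)"
      by (simp add: mode_def abs_mult)
    also have "\<dots> \<le> 1 * (freq j powr 0 * sin x powr 0)"
      using that sin_gt_zero[of x] by (intro mult_mono abs_eig_sin_le) auto
    finally show ?thesis using that sin_gt_zero[of x] by simp
  qed
  have "(\<lambda>i. \<bar>T i / d i\<bar>) summable_on ?S"
  proof (rule nonneg_bdd_above_summable_on)
    show "bdd_above (sum (\<lambda>i. \<bar>T i / d i\<bar>) ` {F. F \<subseteq> ?S \<and> finite F})"
    proof (rule bdd_aboveI2)
      fix F assume "F \<in> {F. F \<subseteq> ?S \<and> finite F}"
      then have "finite F" "F \<subseteq> ?S" by simp_all
      from offres_cover[OF this] obtain n where "F \<subseteq> offres n" by (meson order_refl)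
      then have "(\<Sum>i\<in>F. \<bar>T i / d i\<bar>) \<le> (\<Sum>i\<in>offres n. \<bar>T i / d i\<bar>)"
        by (intro sum_mono2) auto
      then show "(\<Sum>i\<in>F. \<bar>T i / d i\<bar>) \<le> M" using coeff_sum[of n] by linarith
    qed
  qed simp
  \<comment> \<open>At fixed \<open>x\<close> in \<open>(0, pi)\<close> every mode is bounded by
    \<open>1 / sin x\<close>, so this comparison series gives unconditional convergence
    there.\<close>
  then have coeff_abs: "(\<lambda>i. norm (T i / d i * (1 / sin x))) summable_on ?S" for x
    unfolding real_norm_def abs_mult[of "T _ / d _"] by (rule summable_on_cmult_left)
  have L_lim: "(\<lambda>n. L n t x) \<longlonglongrightarrow> L_inv \<omega> w t x" if x: "x \<in> {0<..<pi}" for t x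
  proof -
    have s: "0 < sin x" using x by (intro sin_gt_zero) auto
    have "(\<lambda>i. norm (T i / d i * mode (fst i) (snd i) t x)) summable_on ?S"
    proof (rule Infinite_Sum.abs_summable_on_comparison_test[OF coeff_abs[of x]])
      fix i
      show "norm (T i / d i * mode (fst i) (snd i) t x) \<le> norm (T i / d i * (1 / sin x))"
        using mode_sin[OF x, of "fst i" "snd i" t] s
        unfolding norm_mult by (intro mult_left_mono) (auto simp: field_simps)
    qed
    then have "(\<lambda>i. T i / d i * mode (fst i) (snd i) t x) summable_on ?S"
      by (rule Infinite_Sum.abs_summable_summable)
    then have "((\<lambda>i. T i / d i * mode (fst i) (snd i) t x) has_sum L_inv \<omega> w t x) ?S"
      unfolding L_inv_eq by (rule has_sum_infsum)
    then show ?thesis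
      unfolding has_sum_def L_def by (rule filterlim_compose[OF _ filterlim_offres])
  qed
  \<comment> \<open>The weighted \<open>l^1\<close> sum requires \<open>\<eta> < \<delta>\<close>,
    which halving ensures; the interpolation in \<open>abs_eig_sin_le\<close> requires
    \<open>\<eta> \<le> 1\<close>.\<close>
  define \<eta> where "\<eta> = min (\<delta> / 2) 1"
  have \<eta>: "0 < \<eta>" "\<eta> \<le> 1" "\<eta> < \<delta>" using \<delta> by (auto simp: \<eta>_def)
  define W where "W = (\<Sum>j. \<bar>c1 j\<bar> * freq j powr \<eta>)"
  define G where "G x = W * (\<Sum>j. \<bar>c2 j\<bar>) * M * (2 / pi) * sin x powr (\<eta> - 1)" for x
  have dom: "dominated G (\<lambda>t x. u t x * L n t x * (sin x)\<^sup>2 * (2 / pi))" for n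
    unfolding dominated_def
  proof (intro conjI allI ballI)
    show "set_integrable lborel {0<..<pi} G"
      unfolding G_def using set_integrable_sin_powr[OF \<eta>(1)] by simp
    show "(\<lambda>(t, x). u t x * L n t x * (sin x)\<^sup>2 * (2 / pi)) \<in> borel_measurable (lborel \<Otimes>\<^sub>M lborel)"
      unfolding u_def L_def by measurable
    fix t x :: real assume x: "x \<in> {0<..<pi}"
    then have s: "0 < sin x" by (intro sin_gt_zero) auto
    have 1: "\<bar>V_fun c1 t x\<bar> * sin x \<le> W * sin x powr \<eta>"
      unfolding W_def using \<eta> by (intro V_fun_bound(2) weighted_l1_summable[OF V(1)] x) auto
    have 2: "\<bar>V_fun c2 t x\<bar> * sin x \<le> (\<Sum>j. \<bar>c2 j\<bar>)" by (rule V_fun_sin_le[OF l1(2) x])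
    have 3: "\<bar>L n t x\<bar> * sin x \<le> M"
    proof -
      have "\<bar>L n t x\<bar> * sin x \<le> (\<Sum>i\<in>offres n. \<bar>T i / d i * mode (fst i) (snd i) t x\<bar>) * sin x"
        unfolding L_def using s by (intro mult_right_mono sum_abs) auto
      also have "\<dots> = (\<Sum>i\<in>offres n. \<bar>T i / d i\<bar> * (\<bar>mode (fst i) (snd i) t x\<bar> * sin x))"
        by (simp add: sum_distrib_right abs_mult mult.assoc)
      also have "\<dots> \<le> (\<Sum>i\<in>offres n. \<bar>T i / d i\<bar> * 1)"
        by (intro sum_mono mult_left_mono mode_sin x) auto
      also have "\<dots> \<le> M" using coeff_sum[of n] by simp
      finally show ?thesis .
    qed
    \<comment> \<open>Three factors each use one sine, but the weight offers only two. Multiplying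
      by a third sine and cancelling it at the end leaves the integrable
      \<open>sin x powr (\<eta> - 1)\<close>.\<close>
    have "\<bar>u t x * L n t x * (sin x)\<^sup>2 * (2 / pi)\<bar> * sin x
        = (\<bar>V_fun c1 t x\<bar> * sin x) * (\<bar>V_fun c2 t x\<bar> * sin x) * (\<bar>L n t x\<bar> * sin x) * (2 / pi)"
      using s by (simp add: u_def abs_mult power2_eq_square)
    also have "\<dots> \<le> (W * sin x powr \<eta>) * (\<Sum>j. \<bar>c2 j\<bar>) * M * (2 / pi)"
    proof (rule mult_right_mono[OF mult_mono[OF mult_mono[OF 1 2] 3]])
      show "0 \<le> W * sin x powr \<eta>" using order_trans[OF _ 1] s by simp
      then show "0 \<le> W * sin x powr \<eta> * (\<Sum>j. \<bar>c2 j\<bar>)"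
        using suminf_nonneg[OF l1(2)] by simp
    qed (use s suminf_nonneg[OF l1(2)] in auto)
    also have "\<dots> = G x * sin x"
      using s by (simp add: G_def powr_diff)
    finally show "\<bar>u t x * L n t x * (sin x)\<^sup>2 * (2 / pi)\<bar> \<le> G x"
      using s by (rule mult_right_le_imp_le)
  qed
  have "(\<lambda>n. mixed_int (\<lambda>t x. u t x * L n t x * (sin x)\<^sup>2 * (2 / pi)))
      \<longlonglongrightarrow> mixed_int (\<lambda>t x. u t x * L_inv \<omega> w t x * (sin x)\<^sup>2 * (2 / pi))"
    by (intro mixed_int_tendsto[OF dom] tendsto_mult tendsto_const L_lim)
  also have "mixed_int (\<lambda>t x. u t x * L_inv \<omega> w t x * (sin x)\<^sup>2 * (2 / pi)) = quartic \<omega> c1 c2 c3 c4"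
    by (simp add: quartic_def pairing_eq_mixed_int u_def w_def[abs_def])
  also have "(\<lambda>n. mixed_int (\<lambda>t x. u t x * L n t x * (sin x)\<^sup>2 * (2 / pi)))
      = (\<lambda>n. \<Sum>i\<in>offres n. T i / d i * U i)"
  proof
    fix n
    let ?h = "\<lambda>i t x. V_fun c1 t x * V_fun c2 t x * mode (fst i) (snd i) t x * (sin x)\<^sup>2 * (2 / pi)"
    have "mixed_int (\<lambda>t x. u t x * L n t x * (sin x)\<^sup>2 * (2 / pi))
        = mixed_int (\<lambda>t x. \<Sum>i\<in>offres n. T i / d i * ?h i t x)"
      unfolding L_def u_def sum_distrib_left sum_distrib_right by (simp only: mult_ac)
    also have "\<dots> = (\<Sum>i\<in>offres n. T i / d i * mixed_int (?h i))"
      by (rule mixed_int_sum[OF finite_offres dominated_mode[OF l1(1) order_refl l1(2) order_refl]])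
    finally show "mixed_int (\<lambda>t x. u t x * L n t x * (sin x)\<^sup>2 * (2 / pi))
        = (\<Sum>i\<in>offres n. T i / d i * U i)"
      by (simp add: U_def mode_pairing_def pairing_eq_mixed_int)
  qed
  finally have "(\<lambda>n. \<bar>\<Sum>i\<in>offres n. T i / d i * U i\<bar>) \<longlonglongrightarrow> \<bar>quartic \<omega> c1 c2 c3 c4\<bar>"
    by (rule tendsto_rabs)
  then show ?thesis
    by (rule LIMSEQ_le_const2) (use pair_sum in auto)
qed

section \<open>Assembly of the estimates and choice of the constant\<close>

theorem proposition4p12:
  fixes \<gamma>0 :: real
  assumes "\<gamma>0 > 0"
  shows "\<forall>\<delta>::real. \<delta> > 0 \<longrightarrow> (\<exists>C::real. C > 0 \<and>
    (\<forall>\<gamma> \<omega>. 0 < \<gamma> \<and> \<gamma> < \<gamma>0 \<and> \<omega> \<in> Omega \<gamma> \<longrightarrow>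
      (\<forall>v :: nat \<Rightarrow> nat \<Rightarrow> real. (\<forall>n\<in>{1..4}. v n \<in> V_space (1/2 + \<delta>)) \<longrightarrow>
        \<bar>quartic \<omega> (v 1) (v 2) (v 3) (v 4)\<bar>
          \<le> C * inverse \<gamma> * (\<Prod>n\<in>{1..4}. V_norm (1/2 + \<delta>) (v n))) \<and>
      (\<forall>v :: nat \<Rightarrow> nat \<Rightarrow> real. \<forall>l\<in>{1..4}. (\<forall>n\<in>{1..4}. v n \<in> V_space (2/3 + \<delta>)) \<longrightarrow>
        \<bar>quartic \<omega> (v 1) (v 2) (v 3) (v 4)\<bar>
          \<le> C * inverse \<gamma> * (\<Prod>n\<in>{1..4} - {l}. V_norm (2/3 + \<delta>) (v n))
              * V_norm (- \<delta>) (v l))) \<and>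
    (\<forall>v :: nat \<Rightarrow> nat \<Rightarrow> real. (\<forall>n\<in>{1..4}. v n \<in> V_space (1/2 + \<delta>)) \<longrightarrow>
      \<bar>quartic 1 (v 1) (v 2) (v 3) (v 4)\<bar>
        \<le> C * (\<Prod>n\<in>{1..4}. V_norm (1/2 + \<delta>) (v n))) \<and>
    (\<forall>v :: nat \<Rightarrow> nat \<Rightarrow> real. \<forall>l\<in>{1..4}. (\<forall>n\<in>{1..4}. v n \<in> V_space (2/3 + \<delta>)) \<longrightarrow>
      \<bar>quartic 1 (v 1) (v 2) (v 3) (v 4)\<bar>
        \<le> C * (\<Prod>n\<in>{1..4} - {l}. V_norm (2/3 + \<delta>) (v n)) * V_norm (- \<delta>) (v l)))"
proof (intro allI impI)
  fix \<delta> :: real assume \<delta>: "0 < \<delta>"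
  have I4: "{1..4} = {1, 2, 3, 4::nat}" by auto
  \<comment> \<open>\<open>A\<close> is the constant of \<open>quad_sum_bound_neg\<close> and
    dominates that of \<open>quad_sum_bound\<close>; \<open>R\<close> dominates both resolvent
    constants once \<open>1 / \<gamma>\<close> is factored out. One constant thus serves all four
    estimates.\<close>
  define A where "A = 18 * 3 powr \<delta> * (l1_const \<delta>)\<^sup>2"
  define R where "R = (8 + 9 * \<gamma>0) * res_const + 4 * res_const"
  have "1 \<le> (3::real) powr \<delta>" using \<delta> by (intro ge_one_powr_ge_zero) auto
  then have A6: "6 * (l1_const \<delta>)\<^sup>2 \<le> A"
    unfolding A_def by (intro mult_right_mono) auto
  have A: "0 < A" using l1_const_pos[OF \<delta>] by (simp add: A_def)
  have R: "4 * res_const \<le> R" "(8 + 9 * \<gamma>0) * res_const \<le> R" "0 < R"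
    using assms res_const_pos by (auto simp: R_def intro: add_pos_pos)
  have first: "\<bar>quartic \<omega> (v 1) (v 2) (v 3) (v 4)\<bar>
      \<le> 4 * K * A * (\<Prod>n\<in>{1..4}. V_norm (1/2 + \<delta>) (v n))"
    if K: "resolvent_bound \<omega> K" and v: "\<forall>n\<in>{1..4}. v n \<in> V_space (1/2 + \<delta>)"
    for K \<omega> and v :: "nat \<Rightarrow> nat \<Rightarrow> real"
  proof -
    let ?P = "V_norm (1/2 + \<delta>) (v 1) * V_norm (1/2 + \<delta>) (v 2) * V_norm (1/2 + \<delta>) (v 3) * V_norm (1/2 + \<delta>) (v 4)"
    from v have v': "v 1 \<in> V_space (1/2 + \<delta>)" "v 2 \<in> V_space (1/2 + \<delta>)"
      "v 3 \<in> V_space (1/2 + \<delta>)" "v 4 \<in> V_space (1/2 + \<delta>)" by auto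
    have "6 * (l1_const \<delta>)\<^sup>2 * ?P \<le> A * ?P"
      using v' by (intro mult_right_mono A6 mult_nonneg_nonneg) (auto intro: V_norm_nonneg)
    then have "\<bar>quartic \<omega> (v 1) (v 2) (v 3) (v 4)\<bar> \<le> 4 * K * (A * ?P)"
      by (intro quartic_le[OF \<delta> v' K] order_trans[OF quad_sum_bound[OF \<delta> v']])
    then show ?thesis unfolding I4 by (simp add: mult_ac)
  qed
  have second: "\<bar>quartic \<omega> (v 1) (v 2) (v 3) (v 4)\<bar>
      \<le> 4 * K * A * (\<Prod>n\<in>{1..4} - {l}. V_norm (2/3 + \<delta>) (v n)) * V_norm (- \<delta>) (v l)"
    if K: "resolvent_bound \<omega> K" and v: "\<forall>n\<in>{1..4}. v n \<in> V_space (2/3 + \<delta>)" and l: "l \<in> {1..4}"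
    for K \<omega> l and v :: "nat \<Rightarrow> nat \<Rightarrow> real"
  proof -
    \<comment> \<open>Both orders at which \<open>quad_sum_bound_neg\<close> works,
      \<open>1/2 + \<delta>\<close> and \<open>- \<delta>\<close>, lie below
      \<open>2/3 + \<delta>\<close>.\<close>
    have vs: "v n \<in> V_space (1/2 + \<delta>)" "v n \<in> V_space (- \<delta>)" if "n \<in> {1..4}" for n
      using v that \<delta> by (auto intro: V_space_mono[of _ "2/3 + \<delta>"])
    have vn: "V_norm (1/2 + \<delta>) (v n) \<le> V_norm (2/3 + \<delta>) (v n)"
      "0 \<le> V_norm (1/2 + \<delta>) (v n)" "0 \<le> V_norm (2/3 + \<delta>) (v n)" "0 \<le> V_norm (- \<delta>) (v n)"
      if "n \<in> {1..4}" for n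
      using v that \<delta> vs[OF that] by (auto intro: V_norm_mono V_norm_nonneg)
    have bound: "quad_sum n N (\<lambda>a. \<bar>v i a\<bar>) (\<lambda>b. \<bar>v j b\<bar>) (\<lambda>p. \<bar>v k p\<bar>) (\<lambda>q. \<bar>v m q\<bar>)
        \<le> A * (V_norm (2/3 + \<delta>) (v j) * V_norm (2/3 + \<delta>) (v k) * V_norm (2/3 + \<delta>) (v m) * V_norm (- \<delta>) (v i))"
      if "i \<in> {1..4}" "j \<in> {1..4}" "k \<in> {1..4}" "m \<in> {1..4}" for n N i j k m
    proof -
      have "quad_sum n N (\<lambda>a. \<bar>v i a\<bar>) (\<lambda>b. \<bar>v j b\<bar>) (\<lambda>p. \<bar>v k p\<bar>) (\<lambda>q. \<bar>v m q\<bar>)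
        \<le> A * (V_norm (1/2 + \<delta>) (v j) * V_norm (1/2 + \<delta>) (v k) * V_norm (1/2 + \<delta>) (v m) * V_norm (- \<delta>) (v i))"
        unfolding A_def by (intro quad_sum_bound_neg[OF \<delta>] vs that)
      also have "\<dots> \<le> A * (V_norm (2/3 + \<delta>) (v j) * V_norm (2/3 + \<delta>) (v k) * V_norm (2/3 + \<delta>) (v m) * V_norm (- \<delta>) (v i))"
        using A by (intro mult_left_mono mult_right_mono mult_mono vn that mult_nonneg_nonneg) auto
      finally show ?thesis .
    qed
    \<comment> \<open>The symmetries of \<open>quad_sum\<close> bring slot \<open>l\<close> to the
      front; for \<open>l = 4\<close> this takes a flip followed by a swap.\<close>
    have "quad_sum n N (\<lambda>a. \<bar>v 1 a\<bar>) (\<lambda>b. \<bar>v 2 b\<bar>) (\<lambda>p. \<bar>v 3 p\<bar>) (\<lambda>q. \<bar>v 4 q\<bar>)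
        \<le> A * ((\<Prod>n\<in>{1..4} - {l}. V_norm (2/3 + \<delta>) (v n)) * V_norm (- \<delta>) (v l))" for n N
    proof -
      consider "l = 1" | "l = 2" | "l = 3" | "l = 4" using l unfolding I4 by auto
      then show ?thesis
      proof cases
        case 1
        then have "{1..4} - {l} = {2, 3, 4}" unfolding I4 by auto
        then show ?thesis using bound[of 1 2 3 4 n N] 1 by (simp add: mult_ac)
      next
        case 2
        then have "{1..4} - {l} = {1, 3, 4}" unfolding I4 by auto
        then show ?thesis using bound[of 2 1 3 4 n N] 2 by (simp add: mult_ac quad_sum_swap)
      next
        case 3
        then have "{1..4} - {l} = {1, 2, 4}" unfolding I4 by auto
        then show ?thesis using bound[of 3 4 1 2 n N] 3 by (simp add: mult_ac quad_sum_flip)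
      next
        case 4
        then have "{1..4} - {l} = {1, 2, 3}" unfolding I4 by auto
        moreover have "quad_sum n N (\<lambda>a. \<bar>v 4 a\<bar>) (\<lambda>b. \<bar>v 3 b\<bar>) (\<lambda>p. \<bar>v 1 p\<bar>) (\<lambda>q. \<bar>v 2 q\<bar>)
            = quad_sum n N (\<lambda>a. \<bar>v 1 a\<bar>) (\<lambda>b. \<bar>v 2 b\<bar>) (\<lambda>p. \<bar>v 3 p\<bar>) (\<lambda>q. \<bar>v 4 q\<bar>)"
          by (rule trans[OF quad_sum_flip quad_sum_swap34])
        ultimately show ?thesis using bound[of 4 3 1 2 n N] 4
          by (simp add: mult_ac del: One_nat_def)
      qed
    qed
    then have "\<bar>quartic \<omega> (v 1) (v 2) (v 3) (v 4)\<bar>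
        \<le> 4 * K * (A * ((\<Prod>n\<in>{1..4} - {l}. V_norm (2/3 + \<delta>) (v n)) * V_norm (- \<delta>) (v l)))"
      by (intro quartic_le[OF \<delta> _ _ _ _ K] vs) auto
    then show ?thesis by (simp only: mult.assoc)
  qed
  have P1: "0 \<le> (\<Prod>n\<in>{1..4}. V_norm (1/2 + \<delta>) (v n))"
    if "\<forall>n\<in>{1..4}. v n \<in> V_space (1/2 + \<delta>)" for v :: "nat \<Rightarrow> nat \<Rightarrow> real"
    using that by (intro prod_nonneg) (auto intro: V_norm_nonneg)
  have P2: "0 \<le> (\<Prod>n\<in>{1..4} - {l}. V_norm (2/3 + \<delta>) (v n)) * V_norm (- \<delta>) (v l)"
    if "\<forall>n\<in>{1..4}. v n \<in> V_space (2/3 + \<delta>)" "l \<in> {1..4}" for l and v :: "nat \<Rightarrow> nat \<Rightarrow> real"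
    using that \<delta> by (intro mult_nonneg_nonneg prod_nonneg)
      (auto intro!: V_norm_nonneg intro: V_space_mono[of _ "2/3 + \<delta>"])
  have mono: "y \<le> C' * P" if "y \<le> C * P" "C \<le> C'" "0 \<le> P" for y C C' P :: real
    using that by (meson mult_right_mono order_trans)
  have C1: "4 * (4 * res_const) * A \<le> 4 * R * A"
    using R A by (intro mult_right_mono mult_left_mono) auto
  have CO: "4 * ((8 + 9 * \<gamma>0) / \<gamma> * res_const) * A \<le> 4 * R * A * inverse \<gamma>" if "0 < \<gamma>" for \<gamma>
  proof -
    have "4 * ((8 + 9 * \<gamma>0) / \<gamma> * res_const) * A = 4 * ((8 + 9 * \<gamma>0) * res_const) * A * inverse \<gamma>"
      by (simp add: divide_inverse mult_ac)
    also have "\<dots> \<le> 4 * R * A * inverse \<gamma>"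
      using R A that by (intro mult_right_mono mult_left_mono) auto
    finally show ?thesis .
  qed
  show "\<exists>C::real. C > 0 \<and>
    (\<forall>\<gamma> \<omega>. 0 < \<gamma> \<and> \<gamma> < \<gamma>0 \<and> \<omega> \<in> Omega \<gamma> \<longrightarrow>
      (\<forall>v :: nat \<Rightarrow> nat \<Rightarrow> real. (\<forall>n\<in>{1..4}. v n \<in> V_space (1/2 + \<delta>)) \<longrightarrow>
        \<bar>quartic \<omega> (v 1) (v 2) (v 3) (v 4)\<bar>
          \<le> C * inverse \<gamma> * (\<Prod>n\<in>{1..4}. V_norm (1/2 + \<delta>) (v n))) \<and>
      (\<forall>v :: nat \<Rightarrow> nat \<Rightarrow> real. \<forall>l\<in>{1..4}. (\<forall>n\<in>{1..4}. v n \<in> V_space (2/3 + \<delta>)) \<longrightarrow>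
        \<bar>quartic \<omega> (v 1) (v 2) (v 3) (v 4)\<bar>
          \<le> C * inverse \<gamma> * (\<Prod>n\<in>{1..4} - {l}. V_norm (2/3 + \<delta>) (v n))
              * V_norm (- \<delta>) (v l))) \<and>
    (\<forall>v :: nat \<Rightarrow> nat \<Rightarrow> real. (\<forall>n\<in>{1..4}. v n \<in> V_space (1/2 + \<delta>)) \<longrightarrow>
      \<bar>quartic 1 (v 1) (v 2) (v 3) (v 4)\<bar>
        \<le> C * (\<Prod>n\<in>{1..4}. V_norm (1/2 + \<delta>) (v n))) \<and>
    (\<forall>v :: nat \<Rightarrow> nat \<Rightarrow> real. \<forall>l\<in>{1..4}. (\<forall>n\<in>{1..4}. v n \<in> V_space (2/3 + \<delta>)) \<longrightarrow>
      \<bar>quartic 1 (v 1) (v 2) (v 3) (v 4)\<bar>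
        \<le> C * (\<Prod>n\<in>{1..4} - {l}. V_norm (2/3 + \<delta>) (v n)) * V_norm (- \<delta>) (v l))"
  \<comment> \<open>The 4 comes from \<open>quartic_le\<close>, \<open>R\<close> from the divisors,
    \<open>A\<close> from the quadrilinear sums.\<close>
  proof (intro exI[of _ "4 * R * A"] conjI allI ballI impI)
    show "0 < 4 * R * A" using R A by simp
  next
    fix \<gamma> \<omega> and v :: "nat \<Rightarrow> nat \<Rightarrow> real"
    assume \<gamma>: "0 < \<gamma> \<and> \<gamma> < \<gamma>0 \<and> \<omega> \<in> Omega \<gamma>" and v: "\<forall>n\<in>{1..4}. v n \<in> V_space (1/2 + \<delta>)"
    then show "\<bar>quartic \<omega> (v 1) (v 2) (v 3) (v 4)\<bar>
        \<le> 4 * R * A * inverse \<gamma> * (\<Prod>n\<in>{1..4}. V_norm (1/2 + \<delta>) (v n))"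
      by (intro mono[OF first CO P1] resolvent_bound_Omega) auto
  next
    fix \<gamma> \<omega> and l :: nat and v :: "nat \<Rightarrow> nat \<Rightarrow> real"
    assume \<gamma>: "0 < \<gamma> \<and> \<gamma> < \<gamma>0 \<and> \<omega> \<in> Omega \<gamma>" and l: "l \<in> {1..4}"
      and v: "\<forall>n\<in>{1..4}. v n \<in> V_space (2/3 + \<delta>)"
    then show "\<bar>quartic \<omega> (v 1) (v 2) (v 3) (v 4)\<bar>
        \<le> 4 * R * A * inverse \<gamma> * (\<Prod>n\<in>{1..4} - {l}. V_norm (2/3 + \<delta>) (v n)) * V_norm (- \<delta>) (v l)"
      using mono[OF second[unfolded mult.assoc[of _ "prod _ _"]] CO P2] resolvent_bound_Omega[of \<gamma> \<gamma>0 \<omega>]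
      by (simp only: mult.assoc[of _ "prod _ _"])
  next
    fix v :: "nat \<Rightarrow> nat \<Rightarrow> real"
    assume v: "\<forall>n\<in>{1..4}. v n \<in> V_space (1/2 + \<delta>)"
    then show "\<bar>quartic 1 (v 1) (v 2) (v 3) (v 4)\<bar> \<le> 4 * R * A * (\<Prod>n\<in>{1..4}. V_norm (1/2 + \<delta>) (v n))"
      by (intro mono[OF first C1 P1] resolvent_bound_1)
  next
    fix l :: nat and v :: "nat \<Rightarrow> nat \<Rightarrow> real"
    assume l: "l \<in> {1..4}" and v: "\<forall>n\<in>{1..4}. v n \<in> V_space (2/3 + \<delta>)"
    then show "\<bar>quartic 1 (v 1) (v 2) (v 3) (v 4)\<bar>
        \<le> 4 * R * A * (\<Prod>n\<in>{1..4} - {l}. V_norm (2/3 + \<delta>) (v n)) * V_norm (- \<delta>) (v l)"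
      using mono[OF second[OF resolvent_bound_1, unfolded mult.assoc[of _ "prod _ _"]] C1 P2]
      by (simp only: mult.assoc[of _ "prod _ _"])
  qed
qed

end
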